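(* Suppose $\frac{h_1}{\mu_1}>\frac{h_2}{\mu_2}$ and consider $k\in\{1,\dots,C_1\}$, with $\ell=C_1-k$. 1. $i_D(k)$ is non-decreasing in $k$: $i_D(k-1)\le i_D(k)$ for $k=2,3,\dots,C_1$. 2. Fix $k$ with $\ell=C_1-k<C_2$. If $\mu_1>\mu_2$, then $i_H(k)\le i_D(k)\le i_H(k)+(C_1-1)$. If $\mu_1\le\mu_2$, then $i_D(k)=i_H(k)=\infty$. 3. Fix $k$ with $\ell=C_1-k\ge C_2$. (a) $\frac{h_1}{\mu_1}\le\frac{\ell+1}{C_2}\frac{h_2}{\mu_2}$ if and only if $i_D(k)=0$; and in either case (if $\frac{h_1}{\mu_1}\le\frac{\ell+1}{C_2}\frac{h_2}{\mu_2}$ or if $i_D(k)=0$) $i_H(k)=0$. (b) Suppose $\frac{h_1}{\mu_1}>\frac{\ell+1}{C_2}\frac{h_2}{\mu_2}$, i.e. $i_D(k)\ge1$. Consider the two inequalities $$\text{(Q)}\quad y_k\,r^{\,i_H(k)-k}<\frac{h_0}{h_0-h_2}\bigl(R_2(k)-(i_H(k)-1)\bigr),\qquad \text{(S)}\quad \frac{r_k}{1-q_k}\,y_k\,r^{\,i_H(k)-k}\le\frac{h_0}{h_2-h_0}\bigl(i_H(k)-R_2(k)\bigr).$$ (i) If $h_0\ge h_2$ then $i_H(k)\ge i_D(k)$; if $h_0\le h_2$ then $i_H(k)\le i_D(k)$. Consequently, if $h_0=h_2$, then $i_H(k)=i_D(k)$. (ii) If $h_0>h_2$ and $k$ satisfies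 (Q), then $i_H(k)=i_D(k)$. If $h_0<h_2$ and $k$ satisfies (S), then $i_H(k)=i_D(k)$. (iii) If $k\ge2$ and either $h_0=h_2$, or $h_0>h_2$ and $k$ satisfies (Q), or $h_0<h_2$ and $k$ satisfies (S), then $i_D(k)=i_D(k-1)+1$.
   Context: Let $C_1,C_2\ge1$ be integers with $C_2<C_1$, and $\mu_1,\mu_2,h_0,h_1,h_2>0$ real. Write $\mathbb{Z}_+=\{0,1,2,\dots\}$. Let $$\mathbb{X}=\{(i,k,\ell)\in\mathbb{Z}_+^3 : (i=0 \text{ and } k+\ell<C_1)\text{ or }(i\ge0\text{ and }k+\ell=C_1)\},\qquad d(k,\ell)=k\mu_1+\min\{\ell,C_2\}\mu_2 .$$ The value function $v:\mathbb{X}\to\mathbb{R}$ (optimal expected total holding cost of a clearing queueing system with $i$ jobs in queue, $k$ jobs in independent service and $\ell$ jobs at the collaborative station) is determined by $v(0,0,0)=0$, $$v(0,k,\ell)=\tfrac{kh_1+\ell h_2}{d(k,\ell)}+\tfrac{k\mu_1}{d(k,\ell)}v(0,k-1,\ell)+\tfrac{\min\{\ell,C_2\}\mu_2}{d(k,\ell)}v(0,k,\ell-1)\quad ((k,\ell)\ne(0,0)),$$ and for $i\ge1$, $$v(i,k,\ell)=\tfrac{ih_0+kh_1+\ell h_2}{d(k,\ell)}+\tfrac{k\mu_1}{d(k,\ell)}\min\{v(i-1,k,\ell),v(i-1,k-1,\ell+1)\}+\tfrac{\min\{\ell,C_2\}\mu_2}{d(k,\ell)}\min\{v(i-1,k+1,\ell-1),v(i-1,k,\ell)\},$$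 where terms with coefficient $0$ are read as $0$. For $(i,k,\ell)\in\mathbb{X}$ with $k\ge1$ let $D(i,k,\ell)=v(i,k,\ell)-v(i,k-1,\ell+1)$. Put $m=\mu_2/\mu_1$ and $$c=\tfrac{h_0}{C_1}\bigl(\tfrac1{\mu_1}-\tfrac1{\mu_2}\bigr),\quad b=\tfrac{h_1}{\mu_1}-\tfrac{h_2}{\mu_2},\quad c'=-\tfrac{h_0}{C_2\mu_2},\quad b'=\tfrac{h_1-h_2}{\mu_1}-\tfrac{C_1h_2}{C_2\mu_2}.$$ For $k=1,\dots,C_1$ and $\ell=C_1-k$ put $$y_k=(k-1)+\min\{\ell,C_2\}m,\quad q_k=\frac{k-1}{(k-1)+\min\{\ell+1,C_2\}m},\quad r_k=\frac{\min\{\ell,C_2\}m}{k+\min\{\ell,C_2\}m},\quad r=\frac{C_2m}{1+C_2m},$$ $$R_2(k)=-\frac{b'}{c'}+y_k=\frac{C_2m(h_1-h_2)-C_1h_2}{h_0}+(k-1+C_2m)\quad\text{(used when }\ell\ge C_2).$$ For $i\in\mathbb{Z}_+$, $1\le k\le C_1$, $\ell=C_1-k$, define $$H(i,k,\ell)=\begin{cases}-1&\text{if }\ell\ge C_2\text{ and }\frac{h_1}{\mu_1}\le\frac{\ell+1}{C_2}\frac{h_2}{\mu_2},\\(i-y_k)c'+b'&\text{if }\ell\ge C_2\text{ and }\frac{h_1}{\mu_1}>\frac{\ell+1}{C_2}\frac{h_2}{\mu_2},\\ ic+b&\text{if }\ell<C_2.\end{cases}$$ The actual and estimated integer thresholds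 are $i_D(k)=\min\{i\in\mathbb{Z}_+: D(i,k,C_1-k)\le0\}$ and $i_H(k)=\min\{i\in\mathbb{Z}_+: H(i,k,C_1-k)\le0\}$, with $\min\emptyset=\infty$. *)

theory Defs
  imports Complex_Main "HOL-Library.Extended_Nat"
begin

record clearing_system =
  C1 :: nat
  C2 :: nat
  mu1 :: real
  mu2 :: real
  h0 :: real
  h1 :: real
  h2 :: real

definition valid_system :: "clearing_system \<Rightarrow> bool" where
  "valid_system S \<longleftrightarrow>
     1 \<le> C1 S \<and> 1 \<le> C2 S \<and> C2 S < C1 S \<and>
     0 < mu1 S \<and> 0 < mu2 S \<and> 0 < h0 S \<and> 0 < h1 S \<and> 0 < h2 S"

definition state_space :: "clearing_system \<Rightarrow> (nat \<times> nat \<times> nat) set" where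
  "state_space S = {(i, k, l). (i = 0 \<and> k + l < C1 S) \<or> (i \<ge> 0 \<and> k + l = C1 S)}"

definition d_rate :: "clearing_system \<Rightarrow> nat \<Rightarrow> nat \<Rightarrow> real" where
  "d_rate S k l = real k * mu1 S + real (min l (C2 S)) * mu2 S"

text \<open>
  The value function is written as a total function; at an argument in \<^const>\<open>state_space\<close> it
  only uses values at arguments in \<^const>\<open>state_space\<close>, except in terms with coefficient zero.
  Such terms vanish: for \<open>i = 0\<close> by the explicit conditionals (which termination needs), for
  \<open>i > 0\<close> because their factor \<open>real k\<close> or \<open>real (min l (C2 S))\<close> is zero, whatever the truncated
  subtraction inside the minimum yields.  Lemma \<open>v_fun_unique\<close> below states that the recursion
  on \<^const>\<open>state_space\<close> determines the values there.
\<close>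

fun v_fun :: "clearing_system \<Rightarrow> nat \<Rightarrow> nat \<Rightarrow> nat \<Rightarrow> real" where
  "v_fun S 0 k l =
     (if k = 0 \<and> l = 0 then 0
      else (real k * h1 S + real l * h2 S) / d_rate S k l
         + (if k = 0 then 0
            else real k * mu1 S / d_rate S k l * v_fun S 0 (k - 1) l)
         + (if l = 0 then 0
            else real (min l (C2 S)) * mu2 S / d_rate S k l * v_fun S 0 k (l - 1)))"
| "v_fun S (Suc i) k l =
     (real (Suc i) * h0 S + real k * h1 S + real l * h2 S) / d_rate S k l
     + real k * mu1 S / d_rate S k l
         * min (v_fun S i k l) (v_fun S i (k - 1) (l + 1))
     + real (min l (C2 S)) * mu2 S / d_rate S k l
         * min (v_fun S i (k + 1) (l - 1)) (v_fun S i k l)"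

declare v_fun.simps [simp del]

lemma v_fun_unique:
  assumes w00: "w 0 0 0 = 0"
    and w0: "\<And>k l. (0, k, l) \<in> state_space S \<Longrightarrow> (k, l) \<noteq> (0, 0) \<Longrightarrow>
      w 0 k l = (real k * h1 S + real l * h2 S) / d_rate S k l
        + (if k = 0 then 0 else real k * mu1 S / d_rate S k l * w 0 (k - 1) l)
        + (if l = 0 then 0 else real (min l (C2 S)) * mu2 S / d_rate S k l * w 0 k (l - 1))"
    and wS: "\<And>i k l. 1 \<le> i \<Longrightarrow> (i, k, l) \<in> state_space S \<Longrightarrow>
      w i k l = (real i * h0 S + real k * h1 S + real l * h2 S) / d_rate S k l
        + (if k = 0 then 0 else real k * mu1 S / d_rate S k l
            * min (w (i - 1) k l) (w (i - 1) (k - 1) (l + 1)))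
        + (if l = 0 then 0 else real (min l (C2 S)) * mu2 S / d_rate S k l
            * min (w (i - 1) (k + 1) (l - 1)) (w (i - 1) k l))"
    and "(i, k, l) \<in> state_space S"
  shows "w i k l = v_fun S i k l"
  using assms(4)
proof (induction i arbitrary: k l)
  case 0
  then show ?case
  proof (induction "k + l" arbitrary: k l rule: less_induct)
    case less
    show ?case
    proof (cases "k = 0 \<and> l = 0")
      case True
      then show ?thesis by (simp add: w00 v_fun.simps)
    next
      case False
      have "w 0 (k - 1) l = v_fun S 0 (k - 1) l" if "k \<noteq> 0"
        using less that by (auto simp: state_space_def)
      moreover have "w 0 k (l - 1) = v_fun S 0 k (l - 1)" if "l \<noteq> 0"
        using less that by (auto simp: state_space_def)
      moreover have "(k, l) \<noteq> (0, 0)"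
        using False by simp
      ultimately show ?thesis
        using w0[OF less.prems] False by (auto simp: v_fun.simps(1)[of S k l])
    qed
  qed
next
  case (Suc i)
  have kl: "k + l = C1 S"
    using Suc.prems by (auto simp: state_space_def)
  have "w i k l = v_fun S i k l"
    using Suc.IH kl by (simp add: state_space_def)
  moreover have "w i (k - 1) (l + 1) = v_fun S i (k - 1) (l + 1)" if "k \<noteq> 0"
    using that kl by (intro Suc.IH) (simp add: state_space_def)
  moreover have "w i (k + 1) (l - 1) = v_fun S i (k + 1) (l - 1)" if "l \<noteq> 0"
    using that kl by (intro Suc.IH) (simp add: state_space_def)
  ultimately show ?case
    using wS[OF _ Suc.prems] by (cases "k = 0"; cases "l = 0"; simp add: v_fun.simps(2))
qed

text \<open>Meaningful for \<open>k \<ge> 1\<close> only.\<close>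

definition D_fun :: "clearing_system \<Rightarrow> nat \<Rightarrow> nat \<Rightarrow> nat \<Rightarrow> real" where
  "D_fun S i k l = v_fun S i k l - v_fun S i (k - 1) (l + 1)"

definition m_ratio :: "clearing_system \<Rightarrow> real" where
  "m_ratio S = mu2 S / mu1 S"

definition coef_c :: "clearing_system \<Rightarrow> real" where
  "coef_c S = h0 S / real (C1 S) * (1 / mu1 S - 1 / mu2 S)"

definition coef_b :: "clearing_system \<Rightarrow> real" where
  "coef_b S = h1 S / mu1 S - h2 S / mu2 S"

definition coef_c' :: "clearing_system \<Rightarrow> real" where
  "coef_c' S = - (h0 S / (real (C2 S) * mu2 S))"

definition coef_b' :: "clearing_system \<Rightarrow> real" where
  "coef_b' S =
     (h1 S - h2 S) / mu1 S - real (C1 S) * h2 S / (real (C2 S) * mu2 S)"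

text \<open>
  The quantities indexed by \<open>k\<close> alone are used for \<open>1 \<le> k \<le> C1 S\<close>, with \<open>C1 S - k\<close> jobs at the
  collaborative station.
\<close>

definition y_par :: "clearing_system \<Rightarrow> nat \<Rightarrow> real" where
  "y_par S k = (real k - 1) + real (min (C1 S - k) (C2 S)) * m_ratio S"

definition q_par :: "clearing_system \<Rightarrow> nat \<Rightarrow> real" where
  "q_par S k =
     (real k - 1) / ((real k - 1) + real (min (C1 S - k + 1) (C2 S)) * m_ratio S)"

definition r_par :: "clearing_system \<Rightarrow> nat \<Rightarrow> real" where
  "r_par S k =
     real (min (C1 S - k) (C2 S)) * m_ratio S
       / (real k + real (min (C1 S - k) (C2 S)) * m_ratio S)"

definition r_base :: "clearing_system \<Rightarrow> real" where
  "r_base S = real (C2 S) * m_ratio S / (1 + real (C2 S) * m_ratio S)"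

definition R2_par :: "clearing_system \<Rightarrow> nat \<Rightarrow> real" where
  "R2_par S k = - (coef_b' S / coef_c' S) + y_par S k"

lemma R2_par_explicit:
  assumes "valid_system S" "1 \<le> k" "k \<le> C1 S" "C1 S - k \<ge> C2 S"
  shows "R2_par S k =
    (real (C2 S) * m_ratio S * (h1 S - h2 S) - real (C1 S) * h2 S) / h0 S
      + (real k - 1 + real (C2 S) * m_ratio S)"
proof -
  have "0 < C2 S" "0 < mu1 S" "0 < mu2 S" "0 < h0 S"
    using assms(1) by (auto simp: valid_system_def)
  then have "- (coef_b' S / coef_c' S) =
      (real (C2 S) * m_ratio S * (h1 S - h2 S) - real (C1 S) * h2 S) / h0 S"
    by (simp add: coef_b'_def coef_c'_def m_ratio_def field_simps)
  then show ?thesis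
    using assms(4) by (simp add: R2_par_def y_par_def min_absorb2)
qed

definition H_fun :: "clearing_system \<Rightarrow> nat \<Rightarrow> nat \<Rightarrow> nat \<Rightarrow> real" where
  "H_fun S i k l =
     (if l \<ge> C2 S then
        (if h1 S / mu1 S \<le> (real l + 1) / real (C2 S) * (h2 S / mu2 S) then - 1
         else (real i - y_par S k) * coef_c' S + coef_b' S)
      else real i * coef_c S + coef_b S)"

text \<open>In \<^typ>\<open>enat\<close> the infimum of the empty set is \<open>\<infinity>\<close>.\<close>

definition i_D :: "clearing_system \<Rightarrow> nat \<Rightarrow> enat" where
  "i_D S k = Inf (enat ` {i. D_fun S i k (C1 S - k) \<le> 0})"

definition i_H :: "clearing_system \<Rightarrow> nat \<Rightarrow> enat" where
  "i_H S k = Inf (enat ` {i. H_fun S i k (C1 S - k) \<le> 0})"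

text \<open>
  The two sufficient conditions are used only for \<open>C1 S - k \<ge> C2 S\<close>, where \<^const>\<open>i_H\<close> is finite
  because \<^const>\<open>coef_c'\<close> is negative, so that \<^const>\<open>the_enat\<close> is harmless.  The exponent
  \<open>i_H S k - k\<close> may be negative, hence an integer power.
\<close>

definition cond_Q :: "clearing_system \<Rightarrow> nat \<Rightarrow> bool" where
  "cond_Q S k \<longleftrightarrow>
     y_par S k * r_base S powi (int (the_enat (i_H S k)) - int k)
       < h0 S / (h0 S - h2 S) * (R2_par S k - (real (the_enat (i_H S k)) - 1))"

definition cond_S :: "clearing_system \<Rightarrow> nat \<Rightarrow> bool" where
  "cond_S S k \<longleftrightarrow>
     r_par S k / (1 - q_par S k) * y_par S k
         * r_base S powi (int (the_enat (i_H S k)) - int k)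
       \<le> h0 S / (h2 S - h0 S) * (real (the_enat (i_H S k)) - R2_par S k)"

end

theory Submission
  imports Defs
begin

text \<open>
  Write \<open>N\<close> and \<open>c\<close> for \<^const>\<open>C1\<close> and \<^const>\<open>C2\<close>, and \<open>D i k\<close> for the difference \<^const>\<open>D_fun\<close> in the
  state with queue length \<open>i\<close>, \<open>k\<close> independent jobs and \<open>N - k\<close> collaborative ones; these states form
  column \<open>k\<close>. The queue length plays the role of time. Every question is about the sign of \<open>D i k\<close>.

  Eliminating the minima from the value function shows (\<open>D_Suc\<close>) that \<open>D\<close> obeys a recursion with only
  one family of parameters, the probability \<open>p k\<close> that the next completion is an independent one: the
  new difference is a weighted mean of a resting level, the old difference and its left neighbour, minus
  contributions of negative parts. The resting level is affine in time, with one value for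
  \<open>N - k \<ge> c\<close> and another for \<open>N - k < c\<close>.

  The central step is that the positive parts \<open>P\<close> of the differences are monotone in \<open>k\<close> (lemma
  \<open>regular\<close>) up to the column \<open>K\<close>, right of which all differences are positive (lemma \<open>D_pos_high\<close>).
  This gives the first claim of the theorem. It also implies that the recursion closes on
  \<open>P\<close> (lemma \<open>P_Suc\<close>), as the maximum of zero and a weighted mean, and that nonpositive
  differences stay nonpositive. The right-hand side of this closed recursion is monotone in its
  arguments, so that thresholds can be bounded by sub- and supersolutions.

  Because of \<open>p k * (1 + y k) = k\<close>, the functions \<open>a * (\<beta> + y k - i)\<close> solve the linear recursion
  with resting level \<open>a * (\<beta> - i)\<close> exactly. Cut off at zero they are supersolutions (lemma
  \<open>hinge_bound\<close>), which bounds the threshold for \<open>N - k < c\<close>. For \<open>N - k \<ge> c\<close> the estimate \<open>H\<close> is such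
  a solution, and \<open>D - H\<close> starts out as a multiple of \<open>y k\<close> with the sign of \<open>h2 - h0\<close>; this
  decides on which side of the estimate the threshold lies. Under the homogeneous recursion this
  initial error shrinks to at most a multiple of \<open>y k\<close> times the power \<open>i + 1 - k\<close> of \<open>r\<close> (lemma
  \<open>err_Suc\<close>). The conditions (Q) and (S) say that the remaining error is too small to move the
  integer threshold (lemmas \<open>P_lower\<close> and \<open>nonpos_of_cond_S\<close>). Finally, the estimate for column \<open>k - 1\<close> at time \<open>i - 1\<close> is the one
  for column \<open>k\<close> at time \<open>i\<close>, which gives the shift of the thresholds by one.
\<close>

section \<open>Infima of sets of natural numbers, and weighted means\<close>

lemma Inf_enat_image_le: "n \<in> A \<Longrightarrow> Inf (enat ` A) \<le> enat n"
  by (auto intro: Inf_lower)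

lemma Inf_enat_image_eq:
  assumes "n \<in> A" and "\<And>i. i < n \<Longrightarrow> i \<notin> A"
  shows "Inf (enat ` A) = enat n"
proof (rule antisym)
  show "enat n \<le> Inf (enat ` A)"
    using assms(2) by (force intro!: Inf_greatest simp: not_less[symmetric])
qed (use assms(1) in \<open>rule Inf_enat_image_le\<close>)

lemma Inf_enat_image_attained:
  assumes "Inf (enat ` A) = enat n"
  shows "n \<in> A"
proof -
  have "A \<noteq> {}"
    using assms by (auto simp: top_enat_def)
  then obtain m where m: "m \<in> A" "\<And>i. i < m \<Longrightarrow> i \<notin> A"
    using exists_least_iff[of "\<lambda>i. i \<in> A"] by auto
  then have "n = m"
    using Inf_enat_image_eq[of m A] assms by simp
  with m show ?thesis by simp
qed

text \<open>
  The two lemmas below are the algebra of one time step. A column is updated to a weighted mean of its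
  resting level \<open>t\<close> (weight \<open>p2 - p1\<close>), its own value \<open>z\<close> (weight \<open>1 - p2\<close>) and its left neighbour's
  value \<open>x\<close> (weight \<open>p1\<close>). The order of two adjacent columns survives if the pull of the resting level
  on the right column is at most that on the left one, both measured at the common reference value \<open>x\<close>.
\<close>

lemma average_mono:
  fixes p0 p1 p2 t t' u x z :: real
  assumes "(p2 - p1) * (x - t) \<le> (p1 - p0) * (x - t')" "x \<le> z" "p2 \<le> 1" "p0 * u \<le> p0 * x"
  shows "(p1 - p0) * t' + (1 - p1) * x + p0 * u \<le> (p2 - p1) * t + (1 - p2) * z + p1 * x"
proof -
  have "(1 - p2) * x \<le> (1 - p2) * z" using assms by (intro mult_left_mono) auto
  with assms(1,4) show ?thesis by (simp add: algebra_simps)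
qed

text \<open>
  A shortfall below the resting level, weighted by \<open>p2\<close>, is averaged with the weighted shortfall of the left
  neighbour, with weights \<open>1 - p2\<close> and \<open>p2\<close> that sum to one. This is why \<open>p\<close> is the right weight.
\<close>

lemma average_cone:
  fixes p1 p2 t x z :: real
  assumes "p2 * (t - z) \<le> p1 * (t - x)" "p2 \<le> 1"
  shows "p2 * (t - ((p2 - p1) * t + (1 - p2) * z + p1 * x)) \<le> p1 * (t - x)"
proof -
  have "p2 * (t - ((p2 - p1) * t + (1 - p2) * z + p1 * x))
      = (1 - p2) * (p2 * (t - z)) + p2 * (p1 * (t - x))" by (simp add: algebra_simps)
  also have "\<dots> \<le> (1 - p2) * (p1 * (t - x)) + p2 * (p1 * (t - x))"
    using assms by (intro add_right_mono mult_left_mono) auto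
  finally show ?thesis by (simp add: algebra_simps)
qed

section \<open>The recursion for the differences\<close>

locale clearing =
  fixes S :: clearing_system
  assumes valid: "valid_system S"
    and b_pos: "h1 S / mu1 S > h2 S / mu2 S"
begin

abbreviation N :: nat where "N \<equiv> C1 S"
abbreviation c :: nat where "c \<equiv> C2 S"

text \<open>
  Columns \<open>k \<le> k0\<close> are those in which the collaborative station works at its full rate.
\<close>

definition k0 :: nat where "k0 = N - c"

definition d :: "nat \<Rightarrow> real" where "d k = d_rate S k (N - k)"
abbreviation y :: "nat \<Rightarrow> real" where "y k \<equiv> y_par S k"
definition V :: "nat \<Rightarrow> nat \<Rightarrow> real" where "V i k = v_fun S i k (N - k)"
definition D :: "nat \<Rightarrow> nat \<Rightarrow> real" where "D i k = D_fun S i k (N - k)"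
abbreviation P :: "nat \<Rightarrow> nat \<Rightarrow> real" where "P i k \<equiv> max 0 (D i k)"

text \<open>
  The probability that the next service completion is at the independent station. It carries all rates:
  with \<open>\<ell> = N - k\<close>, one has \<open>q_k = p (k - 1)\<close> and \<open>r_k = 1 - p k\<close>.
\<close>

definition p :: "nat \<Rightarrow> real" where "p k = real k * mu1 S / d k"

text \<open>
  The level at which the differences would rest if the queue length were held at \<open>i\<close>. It depends on \<open>k\<close>
  only through the side of \<open>k0\<close>; for columns right of \<open>k0\<close> it is the estimate \<open>H\<close> itself.
\<close>

definition t_low :: "nat \<Rightarrow> real" where "t_low i = coef_b' S + real i * coef_c' S"

definition t_high :: "nat \<Rightarrow> real" where "t_high i = coef_b S + real i * coef_c S"

definition T :: "nat \<Rightarrow> nat \<Rightarrow> real" where "T i k = (if k \<le> k0 then t_low i else t_high i)"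

lemma params: "1 \<le> c" "c < N" "0 < mu1 S" "0 < mu2 S" "0 < h0 S" "0 < h1 S" "0 < h2 S"
  using valid by (auto simp: valid_system_def)

lemma k0: "1 \<le> k0" "k0 < N" "real k0 = real N - real c" "k \<le> N \<Longrightarrow> k \<le> k0 \<longleftrightarrow> c \<le> N - k"
  using params(1,2) by (auto simp: k0_def of_nat_diff)

lemma d_low: "k \<le> k0 \<Longrightarrow> d k = real k * mu1 S + real c * mu2 S"
  using k0(2) k0(4)[of k] by (simp add: d_def d_rate_def min_absorb2)

lemma d_high: "k0 \<le> k \<Longrightarrow> k \<le> N \<Longrightarrow> d k = real k * mu1 S + (real N - real k) * mu2 S"
  using params(1,2) by (simp add: d_def d_rate_def k0_def min_absorb1 of_nat_diff)

lemma d_pos: "k \<le> N \<Longrightarrow> 0 < d k"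
proof -
  assume k: "k \<le> N"
  show "0 < d k"
  proof (cases "k = 0")
    case True
    then show ?thesis using params by (simp add: d_def d_rate_def)
  next
    case False
    then have "0 < real k * mu1 S" using params by simp
    moreover have "0 \<le> real (min (N - k) c) * mu2 S" using params by simp
    ultimately show ?thesis unfolding d_def d_rate_def by linarith
  qed
qed

text \<open>
  The two boundary values decouple the recursion from the columns \<open>0\<close> and \<open>N + 1\<close>, where truncated
  subtraction gives \<^const>\<open>D_fun\<close> a meaningless value.
\<close>

lemma p_0 [simp]: "p 0 = 0"
  by (simp add: p_def)

lemma p_N [simp]: "p N = 1"
  using params by (simp add: p_def d_def d_rate_def)

lemma one_minus_p: "k \<le> N \<Longrightarrow> 1 - p k = real (min (N - k) c) * mu2 S / d k"
  using d_pos[of k] by (simp add: p_def field_simps) (simp add: d_def d_rate_def)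

lemma p_bounds: "0 \<le> p k" "k \<le> N \<Longrightarrow> p k \<le> 1"
proof -
  show "0 \<le> p k" using params by (simp add: p_def d_def d_rate_def)
  assume "k \<le> N"
  then have "0 \<le> 1 - p k" using params d_pos[of k] by (simp add: one_minus_p)
  then show "p k \<le> 1" by simp
qed

lemma p_pos: "1 \<le> k \<Longrightarrow> k \<le> N \<Longrightarrow> 0 < p k"
  using d_pos[of k] params by (simp add: p_def)

lemma p_diff_low:
  assumes "1 \<le> k" "k \<le> k0"
  shows "p k - p (k - 1) = real c * mu1 S * mu2 S / (d k * d (k - 1))"
proof -
  have "0 < d k" "0 < d (k - 1)" using d_pos assms k0 by auto
  then have "p k - p (k - 1) = (real k * mu1 S * d (k - 1) - real (k - 1) * mu1 S * d k) / (d k * d (k - 1))"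
    by (simp add: p_def diff_frac_eq)
  also have "real k * mu1 S * d (k - 1) - real (k - 1) * mu1 S * d k = real c * mu1 S * mu2 S"
    using assms by (simp add: d_low of_nat_diff algebra_simps)
  finally show ?thesis .
qed

lemma p_diff_high:
  assumes "k0 < k" "k \<le> N"
  shows "p k - p (k - 1) = real N * mu1 S * mu2 S / (d k * d (k - 1))"
proof -
  have "0 < d k" "0 < d (k - 1)" using d_pos assms k0 by auto
  then have "p k - p (k - 1) = (real k * mu1 S * d (k - 1) - real (k - 1) * mu1 S * d k) / (d k * d (k - 1))"
    by (simp add: p_def diff_frac_eq)
  also have "real k * mu1 S * d (k - 1) - real (k - 1) * mu1 S * d k = real N * mu1 S * mu2 S"
    using assms by (simp add: d_high of_nat_diff algebra_simps)
  finally show ?thesis .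
qed

lemma p_less: "1 \<le> k \<Longrightarrow> k \<le> N \<Longrightarrow> p (k - 1) < p k"
proof -
  assume k: "1 \<le> k" "k \<le> N"
  have "0 < d k" "0 < d (k - 1)" using d_pos k by auto
  then have "0 < p k - p (k - 1)"
    using p_diff_low[of k] p_diff_high[of k] k params by (cases "k \<le> k0") auto
  then show ?thesis by simp
qed

lemma d_mono:
  assumes "k \<le> k0 \<or> mu2 S < mu1 S" "1 \<le> k" "k \<le> N"
  shows "d (k - 1) \<le> d k"
proof (cases "k \<le> k0")
  case True
  then show ?thesis using assms params by (simp add: d_low of_nat_diff algebra_simps)
next
  case False
  then show ?thesis using assms by (simp add: d_high of_nat_diff algebra_simps)
qed

text \<open>
  The increment of \<open>p\<close> is a constant over \<open>d k * d (k - 1)\<close>, so \<open>p\<close> is concave wherever the rates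
  increase. The constant jumps from \<open>c * mu1 * mu2\<close> to \<open>N * mu1 * mu2\<close> at \<open>k0\<close>, and concavity may fail there.
\<close>

lemma p_concave:
  assumes "k \<le> k0 \<or> k0 + 2 \<le> k \<and> mu2 S < mu1 S" "2 \<le> k" "k \<le> N"
  shows "p k - p (k - 1) \<le> p (k - 1) - p (k - 1 - 1)"
proof -
  have pos: "0 < d k" "0 < d (k - 1)" "0 < d (k - 1 - 1)" using d_pos assms k0 by auto
  have "d (k - 1 - 1) \<le> d (k - 1)" "d (k - 1) \<le> d k"
    using d_mono[of "k - 1"] d_mono[of k] assms by force+
  then have le: "d (k - 1) * d (k - 1 - 1) \<le> d k * d (k - 1)"
    using pos by (intro mult_mono) auto
  have pos': "0 < d (k - 1) * d (k - 1 - 1)" using pos by simp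
  show ?thesis
  proof (cases "k \<le> k0")
    case True
    then show ?thesis
      using p_diff_low[of k] p_diff_low[of "k - 1"] assms le pos' params
      by (simp add: divide_left_mono)
  next
    case False
    then show ?thesis
      using p_diff_high[of k] p_diff_high[of "k - 1"] assms le pos' params
      by (simp add: divide_left_mono less_diff_conv)
  qed
qed

text \<open>
  This identity makes the linear functions with slope \<open>-1\<close> in time and offset \<open>y k\<close> exact solutions of the
  recursion.
\<close>

lemma p_y: "k \<le> N \<Longrightarrow> p k * (1 + y k) = real k"
proof -
  assume k: "k \<le> N"
  have "mu1 S * (1 + y k) = d k"
    using params by (simp add: d_def d_rate_def y_par_def m_ratio_def field_simps)
  then show ?thesis
    using d_pos[OF k] by (simp add: p_def mult.assoc)
qed

text \<open>
  With an empty queue no decision is left and the cost is a sum over the jobs: each independent job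
  costs \<open>h1\<close> times its mean service time, and the collaborative station is emptied one level at a time.
\<close>

lemma value_without_queue:
  "v_fun S 0 k l = real k * (h1 S / mu1 S)
     + (\<Sum>j=1..l. real j * h2 S / (real (min j c) * mu2 S))"
proof (induction "k + l" arbitrary: k l rule: less_induct)
  case less
  show ?case
  proof (cases "k = 0 \<and> l = 0")
    case True
    then show ?thesis by (simp add: v_fun.simps)
  next
    case False
    let ?F = "\<lambda>l. \<Sum>j=1..l. real j * h2 S / (real (min j c) * mu2 S)"
    let ?v = "real k * (h1 S / mu1 S) + ?F l"
    have dp: "0 < d_rate S k l"
      using False params by (cases "k = 0"; cases "l = 0")
        (auto simp: d_rate_def add_pos_pos add_pos_nonneg)
    have A: "(if k = 0 then 0 else real k * mu1 S / d_rate S k l * v_fun S 0 (k - 1) l)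
        = real k * mu1 S / d_rate S k l * (?v - h1 S / mu1 S)"
    proof (cases "k = 0")
      case False
      then have "v_fun S 0 (k - 1) l = ?v - h1 S / mu1 S"
        using less[of "k - 1" l] by (simp add: of_nat_diff algebra_simps diff_divide_distrib)
      then show ?thesis using False by simp
    qed simp
    have B: "(if l = 0 then 0 else real (min l c) * mu2 S / d_rate S k l * v_fun S 0 k (l - 1))
        = real (min l c) * mu2 S / d_rate S k l * ?v - real l * h2 S / d_rate S k l"
    proof (cases "l = 0")
      case False
      then obtain l' where l: "l = Suc l'" by (cases l) auto
      have "v_fun S 0 k (l - 1) = ?v - real l * h2 S / (real (min l c) * mu2 S)"
        using less[of k l'] l by simp
      moreover have "real (min l c) * mu2 S \<noteq> 0"
        using l params by auto
      ultimately show ?thesis using False by (simp add: right_diff_distrib)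
    qed simp
    have "v_fun S 0 k l = (real k * h1 S + real l * h2 S) / d_rate S k l
        + real k * mu1 S / d_rate S k l * (?v - h1 S / mu1 S)
        + (real (min l c) * mu2 S / d_rate S k l * ?v - real l * h2 S / d_rate S k l)"
      using False unfolding v_fun.simps(1)[of S k l] A B by simp
    also have "\<dots> = (real k * mu1 S + real (min l c) * mu2 S) / d_rate S k l * ?v"
      using dp params by (simp add: add_divide_distrib distrib_right right_diff_distrib)
    also have "\<dots> = ?v"
      using dp by (simp add: d_rate_def)
    finally show ?thesis .
  qed
qed

lemma D_0:
  assumes "1 \<le> k"
  shows "D 0 k = h1 S / mu1 S - (real (N - k) + 1) * h2 S / (real (min (N - k + 1) c) * mu2 S)"
proof -
  obtain k' where k: "k = Suc k'" using assms by (cases k) auto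
  show ?thesis
    by (simp add: k D_def D_fun_def value_without_queue distrib_right add_divide_distrib add.commute)
qed

lemma D_0_low:
  assumes "1 \<le> k" "k \<le> k0"
  shows "D 0 k = h1 S / mu1 S - (real (N - k) + 1) / real c * (h2 S / mu2 S)"
    and "D 0 k = coef_b' S + h2 S / (real c * mu2 S) * y k"
proof -
  have l: "c \<le> N - k" using assms k0 by auto
  then show *: "D 0 k = h1 S / mu1 S - (real (N - k) + 1) / real c * (h2 S / mu2 S)"
    using assms by (simp add: D_0 min_absorb2)
  have N: "real (N - k) = real N - real k" using assms k0 by (simp add: of_nat_diff)
  define a where "a = h2 S / (real c * mu2 S)"
  have h2: "h2 S / mu1 S = a * (real c * m_ratio S)"
    using params by (simp add: a_def m_ratio_def)
  have "D 0 k = h1 S / mu1 S - (real N - real k + 1) * a"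
    unfolding * N by (simp add: a_def)
  moreover have "coef_b' S = h1 S / mu1 S - h2 S / mu1 S - real N * a"
    by (simp add: coef_b'_def a_def diff_divide_distrib)
  moreover have "y k = real k - 1 + real c * m_ratio S"
    using l by (simp add: y_par_def)
  ultimately have "D 0 k = coef_b' S + a * y k"
    unfolding h2 by algebra
  then show "D 0 k = coef_b' S + h2 S / (real c * mu2 S) * y k"
    by (simp add: a_def)
qed

lemma D_0_high:
  assumes "k0 < k" "k \<le> N"
  shows "D 0 k = coef_b S"
proof -
  have "N - k + 1 \<le> c" using assms k0(4)[of k] by linarith
  then have "min (N - k + 1) c = N - k + 1" by simp
  moreover have "real (N - k + 1) = real (N - k) + 1" by simp
  ultimately show ?thesis
    using assms by (simp add: D_0 coef_b_def del: of_nat_add of_nat_Suc)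
qed

lemma cost_rate_diff:
  assumes "1 \<le> k" "k \<le> N"
  shows "(real i * h0 S + real k * h1 S + real (N - k) * h2 S) / d k
       - (real i * h0 S + real (k - 1) * h1 S + real (N - (k - 1)) * h2 S) / d (k - 1)
       = (p k - p (k - 1)) * T i k" (is "?a / _ - ?b / _ = _")
proof -
  have pos: "0 < d k" "0 < d (k - 1)" using d_pos assms by auto
  have "?a / d k - ?b / d (k - 1) = (?a * d (k - 1) - ?b * d k) / (d k * d (k - 1))"
    using pos by (simp add: diff_frac_eq)
  also have "\<dots> = (p k - p (k - 1)) * T i k"
  proof (cases "k \<le> k0")
    case True
    have "real c * mu1 S * mu2 S * coef_b' S = real c * mu2 S * (h1 S - h2 S) - real N * h2 S * mu1 S"
      "real c * mu1 S * mu2 S * coef_c' S = - h0 S * mu1 S"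
      using params by (simp_all add: coef_b'_def coef_c'_def field_simps)
    moreover have "real c * mu1 S * mu2 S * T i k = real c * mu1 S * mu2 S * coef_b' S
        + real i * (real c * mu1 S * mu2 S * coef_c' S)"
      using True by (simp add: T_def t_low_def t_high_def algebra_simps)
    ultimately have "real c * mu1 S * mu2 S * T i k =
        real c * mu2 S * (h1 S - h2 S) - real N * h2 S * mu1 S - real i * h0 S * mu1 S"
      by simp
    then have "?a * d (k - 1) - ?b * d k = real c * mu1 S * mu2 S * T i k"
      using True assms by (simp add: d_low of_nat_diff algebra_simps)
    then show ?thesis using p_diff_low[OF assms(1) True] by (simp only: times_divide_eq_left)
  next
    case False
    have "real N * mu1 S * mu2 S * coef_b S = real N * (mu2 S * h1 S - mu1 S * h2 S)"
      "real N * mu1 S * mu2 S * coef_c S = h0 S * (mu2 S - mu1 S)"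
      using params by (simp_all add: coef_b_def coef_c_def field_simps)
    moreover have "real N * mu1 S * mu2 S * T i k = real N * mu1 S * mu2 S * coef_b S
        + real i * (real N * mu1 S * mu2 S * coef_c S)"
      using False by (simp add: T_def t_low_def t_high_def algebra_simps)
    ultimately have "real N * mu1 S * mu2 S * T i k =
        real N * (mu2 S * h1 S - mu1 S * h2 S) + real i * h0 S * (mu2 S - mu1 S)"
      by simp
    then have "?a * d (k - 1) - ?b * d k = real N * mu1 S * mu2 S * T i k"
      using False assms by (simp add: d_high of_nat_diff algebra_simps)
    then show ?thesis using p_diff_high[of k] False assms by (simp only: times_divide_eq_left not_le)
  qed
  finally show ?thesis .
qed

text \<open>
  A minimum of two values is the value of staying put minus the positive or negative part of a
  difference; this removes the value function from the recursion.
\<close>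

lemma V_Suc:
  assumes "k \<le> N"
  shows "V (Suc i) k = V i k + (real (Suc i) * h0 S + real k * h1 S + real (N - k) * h2 S) / d k
       - p k * max 0 (D i k) - (1 - p k) * max 0 (- D i (k + 1))"
proof -
  let ?s = "real (min (N - k) c) * mu2 S / d k"
  have A: "real k * mu1 S / d k * min (V i k) (v_fun S i (k - 1) (N - k + 1))
      = p k * (V i k - max 0 (D i k))"
    by (cases "k = 0") (auto simp: p_def D_def V_def D_fun_def min_def max_def)
  have B: "?s * min (v_fun S i (k + 1) (N - k - 1)) (V i k) = (1 - p k) * (V i k - max 0 (- D i (k + 1)))"
  proof (cases "k = N")
    case False
    then have "D i (k + 1) = v_fun S i (k + 1) (N - k - 1) - V i k"
      using assms by (simp add: D_def V_def D_fun_def Suc_diff_Suc)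
    then show ?thesis
      using assms by (auto simp: one_minus_p V_def min_def max_def)
  qed simp
  show ?thesis
    using A B by (simp add: V_def d_def v_fun.simps(2)[of S i k] algebra_simps)
qed

text \<open>
  The three weights \<open>p k - p (k - 1)\<close>, \<open>1 - p k\<close> and \<open>p (k - 1)\<close> sum to one: as long as \<open>D\<close> is
  nonnegative, one more queued job replaces a difference by a mean of its resting level, itself and its
  left neighbour.
\<close>

lemma D_Suc:
  assumes "1 \<le> k" "k \<le> N"
  shows "D (Suc i) k = (p k - p (k - 1)) * T (Suc i) k
       + (1 - p k) * P i k + p (k - 1) * P i (k - 1)
       - p (k - 1) * max 0 (- D i k) - (1 - p k) * max 0 (- D i (k + 1))"
proof -
  have D: "D j k = V j k - V j (k - 1)" for j
    using assms by (simp add: D_def V_def D_fun_def Suc_diff_le)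
  have "D (Suc i) k - D i k = (V (Suc i) k - V i k) - (V (Suc i) (k - 1) - V i (k - 1))"
    by (simp add: D)
  also have "\<dots> = (p k - p (k - 1)) * T (Suc i) k
       - p k * max 0 (D i k) - (1 - p k) * max 0 (- D i (k + 1))
       + p (k - 1) * max 0 (D i (k - 1)) + (1 - p (k - 1)) * max 0 (- D i k)"
  proof -
    have *: "k - 1 \<le> N" "k - 1 + 1 = k" using assms by auto
    show ?thesis
      using V_Suc[OF assms(2), of i] V_Suc[OF *(1), of i] cost_rate_diff[OF assms, of "Suc i"]
      unfolding * by linarith
  qed
  finally have "D (Suc i) k - D i k = (p k - p (k - 1)) * T (Suc i) k
       - p k * max 0 (D i k) - (1 - p k) * max 0 (- D i (k + 1))
       + p (k - 1) * max 0 (D i (k - 1)) + (1 - p (k - 1)) * max 0 (- D i k)" .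
  moreover have "D i k = max 0 (D i k) - max 0 (- D i k)" by auto
  ultimately have "D (Suc i) k = max 0 (D i k) - max 0 (- D i k) + ((p k - p (k - 1)) * T (Suc i) k
       - p k * max 0 (D i k) - (1 - p k) * max 0 (- D i (k + 1))
       + p (k - 1) * max 0 (D i (k - 1)) + (1 - p (k - 1)) * max 0 (- D i k))"
    by linarith
  then show ?thesis by (simp only: algebra_simps)
qed

section \<open>The regular order of the differences\<close>

lemma coef_b_pos: "0 < coef_b S"
  using b_pos by (simp add: coef_b_def)

lemma coef_b'_le: "coef_b' S \<le> coef_b S"
proof -
  have "real c \<le> real N" using params by simp
  then have "1 / mu2 S * h2 S \<le> real N / real c / mu2 S * h2 S"
    using params by (intro mult_right_mono divide_right_mono) auto
  moreover have "0 \<le> h2 S / mu1 S" using params by simp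
  ultimately show ?thesis
    by (simp add: coef_b'_def coef_b_def diff_divide_distrib mult.commute)
qed

lemma coef_c'_le: "coef_c' S \<le> coef_c S"
proof -
  have "h0 S / mu2 S / real N \<le> h0 S / mu2 S / real c"
    using params by (intro divide_left_mono) auto
  moreover have "0 \<le> h0 S / real N / mu1 S" using params by simp
  moreover have "coef_c S = h0 S / real N / mu1 S - h0 S / mu2 S / real N"
    by (simp add: coef_c_def right_diff_distrib)
  moreover have "coef_c' S = - (h0 S / mu2 S / real c)"
    by (simp add: coef_c'_def mult.commute)
  ultimately show ?thesis by linarith
qed

lemma coef_c'_neg: "coef_c' S < 0"
  using params by (simp add: coef_c'_def)

lemma coef_c_neg: "mu2 S < mu1 S \<Longrightarrow> coef_c S < 0"
  using params frac_less2[of 1 1 "mu2 S" "mu1 S"] by (simp add: coef_c_def divide_neg_pos mult_pos_neg)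

lemma coef_c_nonneg: "mu1 S \<le> mu2 S \<Longrightarrow> 0 \<le> coef_c S"
  using params by (simp add: coef_c_def frac_le)

lemma coef_b_le: "coef_b S \<le> h1 S / mu1 S"
  using params by (simp add: coef_b_def)

lemma t_low_Suc: "t_low (Suc i) \<le> t_low i"
  using coef_c'_neg by (simp add: t_low_def algebra_simps)

lemma t_high_Suc: "mu2 S < mu1 S \<Longrightarrow> t_high (Suc i) \<le> t_high i"
  using coef_c_neg by (simp add: t_high_def algebra_simps)

lemma t_low_le_t_high: "t_low i \<le> t_high i"
  using coef_b'_le coef_c'_le by (simp add: t_low_def t_high_def add_mono mult_left_mono)

lemma t_low_le: "t_low i \<le> h1 S / mu1 S"
  using coef_b'_le coef_b_le coef_c'_neg mult_nonneg_nonpos[of "real i" "coef_c' S"]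
  by (simp add: t_low_def)

lemma t_high_le: "mu2 S < mu1 S \<Longrightarrow> t_high i \<le> h1 S / mu1 S"
  using coef_b_le coef_c_neg mult_nonneg_nonpos[of "real i" "coef_c S"]
  by (simp add: t_high_def)

text \<open>
  Here a collaborative server is at least as fast as an independent one, so right of \<open>k0\<close> the resting
  levels are positive, and no column left of \<open>k0\<close> can pull a difference below zero.
\<close>

lemma D_pos_high:
  assumes "mu1 S \<le> mu2 S" "k0 < k" "k \<le> N"
  shows "0 < D i k"
  using assms(2,3)
proof (induction i arbitrary: k)
  case 0
  then show ?case using coef_b_pos by (simp add: D_0_high)
next
  case (Suc i)
  have k: "1 \<le> k" using Suc.prems by simp
  have "0 < T (Suc i) k"
    using coef_b_pos coef_c_nonneg[OF assms(1)] Suc.prems by (simp add: T_def t_high_def add_pos_nonneg)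
  then have "0 < (p k - p (k - 1)) * T (Suc i) k"
    using p_less[OF k Suc.prems(2)] by simp
  moreover have "0 \<le> (1 - p k) * P i k" "0 \<le> p (k - 1) * P i (k - 1)"
    using p_bounds[of k] p_bounds[of "k - 1"] Suc.prems by auto
  moreover have "p (k - 1) * max 0 (- D i k) = 0"
    using Suc.IH[OF Suc.prems] by simp
  moreover have "(1 - p k) * max 0 (- D i (k + 1)) = 0"
  proof (cases "k = N")
    case False
    then have "0 < D i (k + 1)" using Suc.IH[of "k + 1"] Suc.prems by simp
    then show ?thesis by simp
  qed simp
  ultimately show ?case
    using D_Suc[OF k Suc.prems(2), of i] by linarith
qed

text \<open>
  The columns whose differences need control: for \<open>mu1 \<le> mu2\<close> those right of \<open>k0\<close> are always positive.
\<close>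

definition K :: nat where "K = (if mu2 S < mu1 S then N else k0)"

lemma K: "k \<le> K \<Longrightarrow> k \<le> N" "k0 \<le> K" "k0 < K \<Longrightarrow> mu2 S < mu1 S \<and> K = N"
  using k0 by (auto simp: K_def split: if_splits)

lemma T_Suc: "k \<le> K \<Longrightarrow> T (Suc i) k \<le> T i k"
  using t_low_Suc t_high_Suc K(3) by (auto simp: T_def)

lemma T_le: "k \<le> K \<Longrightarrow> T i k \<le> h1 S / mu1 S"
  using t_low_le t_high_le K(3) by (auto simp: T_def)

text \<open>
  The induction hypothesis on the queue length. The point is the first clause, monotonicity in \<open>k\<close>; the
  others make it inductive. Left of \<open>k0\<close>, the third clause keeps the values above the falling resting
  level, so concavity of \<open>p\<close> gives the right column the weaker downward pull. Right of \<open>k0\<close> the values may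
  drop below the resting level, because the columns left of \<open>k0\<close> fall faster. The pull is then
  upward, and again weaker in the right column. The last clause compensates for this: the shortfalls,
  weighted by \<open>p\<close>, decrease in \<open>k\<close>, which is stronger than monotonicity. The second clause controls the
  kink of \<open>p\<close>, and the fourth makes the resting level nonpositive wherever a difference is.
\<close>

definition regular :: "nat \<Rightarrow> bool" where
  "regular i \<longleftrightarrow>
     (\<forall>k. 2 \<le> k \<and> k \<le> K \<longrightarrow> P i (k - 1) \<le> P i k)
   \<and> (\<forall>k. 1 \<le> k \<and> k \<le> K \<longrightarrow> P i k \<le> h1 S / mu1 S)
   \<and> (\<forall>k. 1 \<le> k \<and> k \<le> k0 \<longrightarrow> t_low i \<le> P i k)
   \<and> (\<forall>k. k0 < k \<and> k \<le> K \<longrightarrow> 0 < t_high i \<longrightarrow> 0 < P i k)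
   \<and> (\<forall>k. k0 < k \<and> k \<le> K \<longrightarrow> P i (k - 1) \<le> t_high i \<longrightarrow>
        p k * (t_high i - P i k) \<le> p (k - 1) * (t_high i - P i (k - 1)))"

lemma regularD:
  assumes "regular i"
  shows "2 \<le> k \<Longrightarrow> k \<le> K \<Longrightarrow> P i (k - 1) \<le> P i k"
    and "1 \<le> k \<Longrightarrow> k \<le> K \<Longrightarrow> P i k \<le> h1 S / mu1 S"
    and "1 \<le> k \<Longrightarrow> k \<le> k0 \<Longrightarrow> t_low i \<le> P i k"
    and "k0 < k \<Longrightarrow> k \<le> K \<Longrightarrow> 0 < t_high i \<Longrightarrow> 0 < P i k"
    and "k0 < k \<Longrightarrow> k \<le> K \<Longrightarrow> P i (k - 1) \<le> t_high i \<Longrightarrow>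
           p k * (t_high i - P i k) \<le> p (k - 1) * (t_high i - P i (k - 1))"
  using assms unfolding regular_def by blast+

lemma weighted_P_pred:
  assumes "regular i" "1 \<le> k" "k \<le> K"
  shows "p (k - 1) * P i (k - 1) \<le> p (k - 1) * P i k"
proof (cases "k = 1")
  case False
  then show ?thesis
    using regularD(1)[OF assms(1), of k] assms by (intro mult_left_mono p_bounds) auto
qed simp

text \<open>
  A vanishing positive part certifies that the resting level is nonpositive, now and, as it is falling,
  forever; with monotonicity in \<open>k\<close>, a difference that has become nonpositive therefore stays so.
\<close>

lemma T_nonpos:
  assumes "regular i" "1 \<le> k" "k \<le> K" "D i k \<le> 0"
  shows "T (Suc i) k \<le> 0"
proof -
  have "T i k \<le> 0"
    using regularD(3,4)[OF assms(1), of k] assms(2-) by (auto simp: T_def not_less[symmetric])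
  then show ?thesis using T_Suc[OF assms(3), of i] by simp
qed

text \<open>
  Under monotonicity the recursion closes on the positive parts: if \<open>D i k > 0\<close>, then also
  \<open>D i (k + 1) > 0\<close> and no negative part enters; otherwise the positive parts of columns \<open>k\<close> and \<open>k - 1\<close>
  vanish and the new difference is nonpositive as well.
\<close>

lemma P_Suc:
  assumes "regular i" "1 \<le> k" "k \<le> K"
  shows "P (Suc i) k =
    max 0 ((p k - p (k - 1)) * T (Suc i) k + (1 - p k) * P i k + p (k - 1) * P i (k - 1))"
proof (cases "D i k \<le> 0")
  case True
  have kN: "k \<le> N" using K assms by auto
  have pred: "p (k - 1) * P i (k - 1) = 0"
  proof (rule antisym)
    have "P i k = 0" using True by simp
    then show "p (k - 1) * P i (k - 1) \<le> 0" using weighted_P_pred[OF assms] by simp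
  qed (simp add: p_bounds)
  have "(p k - p (k - 1)) * T (Suc i) k \<le> 0"
    using p_less[OF assms(2) kN] T_nonpos[OF assms True] by (simp add: mult_nonneg_nonpos)
  moreover have "0 \<le> p (k - 1) * max 0 (- D i k)" "0 \<le> (1 - p k) * max 0 (- D i (k + 1))"
    using p_bounds[of k] p_bounds[of "k - 1"] kN by auto
  moreover have P0: "P i k = 0" using True by simp
  ultimately have "D (Suc i) k \<le> 0"
    using D_Suc[OF assms(2) kN, of i] unfolding pred P0 by linarith
  with \<open>(p k - p (k - 1)) * T (Suc i) k \<le> 0\<close> show ?thesis
    unfolding pred P0 by simp
next
  case False
  have kN: "k \<le> N" using K assms by auto
  have "(1 - p k) * max 0 (- D i (k + 1)) = 0"
  proof (cases "k = N")
    case kN': False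
    have "0 < D i (k + 1)"
    proof (cases "k = K")
      case True
      then show ?thesis
        using D_pos_high[of "k + 1" i] kN' K_def k0 by (auto split: if_splits)
    next
      case kK: False
      then show ?thesis
        using regularD(1)[OF assms(1), of "k + 1"] assms False
        by (auto simp: max_def split: if_splits)
    qed
    then show ?thesis by simp
  qed simp
  moreover have "p (k - 1) * max 0 (- D i k) = 0" using False by simp
  ultimately have "D (Suc i) k =
      (p k - p (k - 1)) * T (Suc i) k + (1 - p k) * P i k + p (k - 1) * P i (k - 1)"
    using D_Suc[OF assms(2) kN, of i] by linarith
  then show ?thesis by (rule arg_cong)
qed

text \<open>
  At the kink the weight \<open>p k - p (k - 1)\<close> may jump up by a factor less than \<open>N / c\<close>, but the resting level
  jumps up as well. The upper bound on \<open>x\<close> makes the second effect win: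
  \<open>(N - c) * x \<le> N * t_high i - c * t_low i\<close>, where the right-hand side is
  \<open>((N - c) * h1 + c * h2 + i * h0) / mu1\<close>.
\<close>

lemma kink_drift:
  assumes "mu2 S < mu1 S" "x \<le> h1 S / mu1 S" "t_high i \<le> x" "t_low i \<le> x"
  shows "(p (k0 + 1) - p k0) * (x - t_high i) \<le> (p k0 - p (k0 - 1)) * (x - t_low i)"
proof -
  have d: "0 < d (k0 + 1)" "0 < d k0" "0 < d (k0 - 1)" "d (k0 - 1) \<le> d k0" "d k0 \<le> d (k0 + 1)"
    using d_pos[of "k0 + 1"] d_pos[of k0] d_pos[of "k0 - 1"] d_mono[of k0] d_mono[of "k0 + 1"] k0 assms(1)
    by auto
  have *: "real N * (x - t_high i) \<le> real c * (x - t_low i)"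
  proof -
    have "mu1 S * (real N * t_high i - real c * t_low i) = (real N - real c) * h1 S + real c * h2 S + real i * h0 S"
    proof -
      have eqs: "real N * mu1 S * coef_b S = real N * h1 S - real N * (mu1 S / mu2 S * h2 S)"
        "real N * mu1 S * coef_c S = h0 S * (1 - mu1 S / mu2 S)"
        "real c * mu1 S * coef_b' S = real c * (h1 S - h2 S) - real N * (mu1 S / mu2 S * h2 S)"
        "real c * mu1 S * coef_c' S = - h0 S * (mu1 S / mu2 S)"
        using params by (simp_all add: coef_b_def coef_c_def coef_b'_def coef_c'_def field_simps)
      have "mu1 S * (real N * t_high i - real c * t_low i) =
          real N * mu1 S * coef_b S + real i * (real N * mu1 S * coef_c S)
          - real c * mu1 S * coef_b' S - real i * (real c * mu1 S * coef_c' S)"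
        by (simp add: t_high_def t_low_def algebra_simps)
      then show ?thesis
        unfolding eqs by (simp add: algebra_simps)
    qed
    moreover have "mu1 S * ((real N - real c) * x) \<le> (real N - real c) * h1 S"
      using mult_left_mono[OF assms(2), of "mu1 S * (real N - real c)"] params by simp
    moreover have "0 \<le> real c * h2 S" "0 \<le> real i * h0 S" using params by auto
    ultimately have "mu1 S * ((real N - real c) * x) \<le> mu1 S * (real N * t_high i - real c * t_low i)"
      by linarith
    then have "(real N - real c) * x \<le> real N * t_high i - real c * t_low i"
      using params by simp
    then show ?thesis by (simp add: algebra_simps)
  qed
  have "(p (k0 + 1) - p k0) * (x - t_high i) = mu1 S * mu2 S * (real N * (x - t_high i)) / (d (k0 + 1) * d k0)"
    using p_diff_high[of "k0 + 1"] k0 by (simp add: ac_simps)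
  also have "\<dots> \<le> mu1 S * mu2 S * (real N * (x - t_high i)) / (d k0 * d (k0 - 1))"
    using d params assms by (intro divide_left_mono) (auto simp: mult.commute[of "d k0"] mult_right_mono)
  also have "\<dots> \<le> mu1 S * mu2 S * (real c * (x - t_low i)) / (d k0 * d (k0 - 1))"
    using d params * by (intro divide_right_mono mult_left_mono) auto
  also have "\<dots> = (p k0 - p (k0 - 1)) * (x - t_low i)"
    using p_diff_low[of k0] k0 by (simp add: ac_simps)
  finally show ?thesis .
qed

lemma D_0_le_b:
  assumes "1 \<le> k" "k \<le> N"
  shows "D 0 k \<le> coef_b S"
proof (cases "k \<le> k0")
  case True
  have "real c \<le> real (N - k) + 1" using True k0 by (auto simp: k0_def)
  then have "1 * (h2 S / mu2 S) \<le> (real (N - k) + 1) / real c * (h2 S / mu2 S)"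
    using params by (intro mult_right_mono) auto
  then show ?thesis using D_0_low(1)[OF assms(1) True] by (simp add: coef_b_def)
next
  case False
  then show ?thesis using D_0_high[of k] assms by auto
qed

lemma regular_0: "regular 0"
  unfolding regular_def
proof (intro conjI allI impI)
  fix k
  have D_le: "D 0 k \<le> coef_b S" if "1 \<le> k" "k \<le> K" for k
    using D_0_le_b K that by auto
  show "P 0 (k - 1) \<le> P 0 k" if "2 \<le> k \<and> k \<le> K"
  proof -
    have "D 0 (k - 1) \<le> D 0 k"
    proof (cases "k \<le> k0")
      case True
      have "(real (N - k) + 1) / real c * (h2 S / mu2 S)
          \<le> (real (N - (k - 1)) + 1) / real c * (h2 S / mu2 S)"
        using params that by (intro mult_right_mono divide_right_mono) auto
      then show ?thesis
        using D_0_low(1)[of k] D_0_low(1)[of "k - 1"] True that by linarith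
    next
      case False
      then have "D 0 k = coef_b S" using D_0_high[of k] K that by auto
      moreover have "D 0 (k - 1) \<le> coef_b S" using D_le[of "k - 1"] that by force
      ultimately show ?thesis by simp
    qed
    then show ?thesis by auto
  qed
  show "P 0 k \<le> h1 S / mu1 S" if "1 \<le> k \<and> k \<le> K"
    using D_le[of k] coef_b_le params that by auto
  show "t_low 0 \<le> P 0 k" if "1 \<le> k \<and> k \<le> k0"
  proof -
    have "0 \<le> y k" using that by (simp add: y_par_def m_ratio_def params less_imp_le)
    then have "0 \<le> h2 S / (real c * mu2 S) * y k" using params by simp
    then have "t_low 0 \<le> D 0 k" using D_0_low(2)[of k] that by (simp add: t_low_def)
    then show ?thesis by auto
  qed
  show "0 < P 0 k" if "k0 < k \<and> k \<le> K"
    using D_0_high[of k] K that coef_b_pos by auto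
  show "p k * (t_high 0 - P 0 k) \<le> p (k - 1) * (t_high 0 - P 0 (k - 1))"
    if k: "k0 < k \<and> k \<le> K" and le: "P 0 (k - 1) \<le> t_high 0"
  proof -
    have "P 0 k = t_high 0" using D_0_high[of k] K k coef_b_pos by (auto simp: t_high_def)
    moreover have "0 \<le> p (k - 1) * (t_high 0 - P 0 (k - 1))" using le p_bounds by simp
    ultimately show ?thesis by simp
  qed
qed

text \<open>
  For adjacent columns with \<open>x\<close> the value of the left one, there are two regimes. If \<open>x\<close> is at most the
  new resting level \<open>t\<close> right of \<open>k0\<close>, the weighted shortfalls are compared. Otherwise the pull is
  downward, and concavity of \<open>p\<close> (or \<open>kink_drift\<close> at the kink) lets \<open>average_mono\<close> apply.
\<close>

lemma regular_Suc:
  assumes reg: "regular i"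
  shows "regular (Suc i)"
proof -
  define new where "new k = (p k - p (k - 1)) * T (Suc i) k + (1 - p k) * P i k + p (k - 1) * P i (k - 1)" for k
  have P_new: "P (Suc i) k = max 0 (new k)" if "1 \<le> k" "k \<le> K" for k
    using P_Suc[OF reg that] by (simp add: new_def)
  define t where "t = t_high (Suc i)"
  have step: "P (Suc i) (k - 1) \<le> P (Suc i) k \<and>
      (k0 < k \<longrightarrow> P (Suc i) (k - 1) \<le> t \<longrightarrow>
        p k * (t - P (Suc i) k) \<le> p (k - 1) * (t - P (Suc i) (k - 1)))"
    if k: "2 \<le> k" "k \<le> K" for k
  proof -
    have kN: "k \<le> N" and k1: "1 \<le> k - 1" "k - 1 \<le> K" "1 \<le> k" using k K by auto
    have p: "0 < p (k - 1)" "p (k - 1) < p k" "p k \<le> 1" "p (k - 1) \<le> 1"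
      using p_pos[of "k - 1"] p_less[of k] p_bounds(2)[of k] p_bounds(2)[of "k - 1"] k k1 kN by auto
    define x where "x = P i (k - 1)"
    have x0: "0 \<le> x" by (simp add: x_def)
    have x_le: "x \<le> P i k" using regularD(1)[OF reg k] by (simp add: x_def)
    have u_le: "p (k - 1 - 1) * P i (k - 1 - 1) \<le> p (k - 1 - 1) * x"
      using weighted_P_pred[OF reg k1(1,2)] by (simp add: x_def)
    have low: "t_low (Suc i) \<le> x" if "k - 1 \<le> k0"
      using regularD(3)[OF reg k1(1) that] t_low_Suc[of i] by (simp add: x_def)
    have new_k: "new k = (p k - p (k - 1)) * T (Suc i) k + (1 - p k) * P i k + p (k - 1) * x"
      and new_k1: "new (k - 1) = (p (k - 1) - p (k - 1 - 1)) * T (Suc i) (k - 1) + (1 - p (k - 1)) * x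
          + p (k - 1 - 1) * P i (k - 1 - 1)"
      by (simp_all add: new_def x_def)
    show ?thesis
    proof (cases "k0 < k \<and> x \<le> t")
      case True
      then have mu: "mu2 S < mu1 S" using K k by auto
      have T_k: "T (Suc i) k = t" using True by (simp add: T_def t_def)
      \<comment> \<open>The clause on shortfalls survives lowering the level, since \<open>p\<close> increases.\<close>
      have shift: "p k' * (t - P i k') \<le> p (k' - 1) * (t - P i (k' - 1))"
        if k': "k0 < k'" "k' \<le> K" "P i (k' - 1) \<le> t" for k'
      proof -
        have tt: "t \<le> t_high i" using t_high_Suc[OF mu] by (simp add: t_def)
        then have "p k' * (t_high i - P i k') \<le> p (k' - 1) * (t_high i - P i (k' - 1))"
          using regularD(5)[OF reg k'(1,2)] k'(3) by simp
        moreover have "p (k' - 1) * (t_high i - t) \<le> p k' * (t_high i - t)"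
          using tt p_less[of k'] k' K(1)[of k'] by (intro mult_right_mono) auto
        ultimately show ?thesis by (simp add: algebra_simps)
      qed
      have cone: "p k * (t - new k) \<le> p (k - 1) * (t - x)"
        unfolding new_k T_k using True p(3) shift[of k] k
        by (intro average_cone) (auto simp: x_def)
      \<comment> \<open>The left column does not increase, so its weighted shortfall stays above the old one.\<close>
      have "new (k - 1) \<le> x"
      proof (cases "k - 1 \<le> k0")
        case True
        then have "T (Suc i) (k - 1) \<le> x" using low by (simp add: T_def)
        then have "(p (k - 1) - p (k - 1 - 1)) * T (Suc i) (k - 1) \<le> (p (k - 1) - p (k - 1 - 1)) * x"
          using p_less[of "k - 1"] k1 K(1) by (intro mult_left_mono) auto
        then show ?thesis using u_le unfolding new_k1 by (simp add: algebra_simps)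
      next
        case False
        have "P i (k - 1 - 1) \<le> t"
          using regularD(1)[OF reg, of "k - 1"] False k1 k0(1) \<open>k0 < k \<and> x \<le> t\<close>
          unfolding x_def by linarith
        then have "p (k - 1) * (t - x) \<le> p (k - 1 - 1) * (t - P i (k - 1 - 1))"
          using shift[of "k - 1"] False k1 by (simp add: x_def)
        moreover have "T (Suc i) (k - 1) = t" using False by (simp add: T_def t_def)
        ultimately show ?thesis unfolding new_k1 by (simp add: algebra_simps)
      qed
      then have P_k1: "P (Suc i) (k - 1) \<le> x" using P_new[OF k1(1,2)] x0 by simp
      have "p k * (t - P (Suc i) k) \<le> p k * (t - new k)"
        using P_new[OF k1(3) k(2)] p by (intro mult_left_mono) auto
      also note cone
      also have "p (k - 1) * (t - x) \<le> p (k - 1) * (t - P (Suc i) (k - 1))"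
        using P_k1 p by (intro mult_left_mono) auto
      finally have *: "p k * (t - P (Suc i) k) \<le> p (k - 1) * (t - P (Suc i) (k - 1))" .
      also have "\<dots> \<le> p k * (t - P (Suc i) (k - 1))"
        using P_k1 p True by (intro mult_right_mono) auto
      finally have "P (Suc i) (k - 1) \<le> P (Suc i) k" using p by simp
      with * show ?thesis by blast
    next
      case False
      have "(p k - p (k - 1)) * (x - T (Suc i) k) \<le> (p (k - 1) - p (k - 1 - 1)) * (x - T (Suc i) (k - 1))"
      proof (cases "k = k0 + 1")
        case True
        then show ?thesis
          using kink_drift[of x "Suc i"] regularD(2)[OF reg k1(1,2)] low False K k
          by (auto simp: T_def t_def x_def)
      next
        case kink: False
        have "T (Suc i) k = T (Suc i) (k - 1)" using kink by (auto simp: T_def)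
        moreover have "T (Suc i) k \<le> x" using low False kink by (auto simp: T_def t_def)
        moreover have "p k - p (k - 1) \<le> p (k - 1) - p (k - 1 - 1)"
          using p_concave[of k] kink k kN K by force
        ultimately show ?thesis by (simp add: mult_right_mono)
      qed
      then have "new (k - 1) \<le> new k"
        unfolding new_k new_k1 using x_le p u_le by (intro average_mono)
      then have mono: "P (Suc i) (k - 1) \<le> P (Suc i) k"
        using P_new[OF k1(3) k(2)] P_new[OF k1(1,2)] by simp
      have "p k * (t - P (Suc i) k) \<le> p (k - 1) * (t - P (Suc i) (k - 1))"
        if hi: "k0 < k" and le: "P (Suc i) (k - 1) \<le> t"
      proof -
        have "t \<le> x" using False hi by simp
        then have "0 \<le> (1 - p k) * (P i k - t) + p (k - 1) * (x - t)"
          using x_le p by (intro add_nonneg_nonneg mult_nonneg_nonneg) auto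
        also have "\<dots> = new k - t"
          using hi unfolding new_k by (simp add: T_def t_def algebra_simps)
        finally have "t \<le> P (Suc i) k" using P_new[OF k1(3) k(2)] by simp
        then have "p k * (t - P (Suc i) k) \<le> 0" using p by (simp add: mult_nonneg_nonpos)
        also have "0 \<le> p (k - 1) * (t - P (Suc i) (k - 1))" using p le by simp
        finally show ?thesis .
      qed
      with mono show ?thesis by blast
    qed
  qed
  have nonneg: "0 \<le> (1 - p k) * P i k" "0 \<le> p (k - 1) * P i (k - 1)" if "k \<le> K" for k
    using p_bounds[of k] p_bounds[of "k - 1"] K(1)[OF that] by auto
  have upper: "P (Suc i) k \<le> h1 S / mu1 S" if k: "1 \<le> k" "k \<le> K" for k
  proof -
    have kN: "k \<le> N" using K k by auto
    let ?h = "h1 S / mu1 S"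
    have Pk: "P i k \<le> ?h" by (rule regularD(2)[OF reg k])
    have "(p k - p (k - 1)) * T (Suc i) k \<le> (p k - p (k - 1)) * ?h"
      using p_less[OF k(1) kN] T_le[OF k(2)] by (intro mult_left_mono) auto
    moreover have "(1 - p k) * P i k \<le> (1 - p k) * ?h"
      using Pk p_bounds(2)[OF kN] by (intro mult_left_mono) auto
    moreover have "p (k - 1) * P i (k - 1) \<le> p (k - 1) * ?h"
      using weighted_P_pred[OF reg k] mult_left_mono[OF Pk p_bounds(1)[of "k - 1"]] by linarith
    moreover have "(p k - p (k - 1)) * ?h + (1 - p k) * ?h + p (k - 1) * ?h = ?h"
      by (simp only: left_diff_distrib)
    ultimately have "new k \<le> ?h" unfolding new_def by linarith
    then show ?thesis using P_new[OF k] params by simp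
  qed
  have low: "t_low (Suc i) \<le> P (Suc i) k" if k: "1 \<le> k" "k \<le> k0" for k
  proof -
    have kN: "k \<le> N" and kK: "k \<le> K" using k0 K k by auto
    have "(1 - p k) * t_low (Suc i) \<le> (1 - p k) * P i k"
      using regularD(3)[OF reg k] t_low_Suc[of i] p_bounds(2)[OF kN] by (intro mult_left_mono) auto
    moreover have "p (k - 1) * t_low (Suc i) \<le> p (k - 1) * P i (k - 1)"
    proof (cases "k = 1")
      case False
      then show ?thesis
        using order_trans[OF t_low_Suc regularD(3)[OF reg, of "k - 1"]] k
        by (intro mult_left_mono p_bounds) auto
    qed simp
    ultimately have "t_low (Suc i) \<le> new k" unfolding new_def using k by (simp add: T_def algebra_simps)
    then show ?thesis using P_new[OF k(1) kK] by simp
  qed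
  have high: "0 < P (Suc i) k" if k: "k0 < k" "k \<le> K" and pos: "0 < t_high (Suc i)" for k
  proof -
    have "0 < (p k - p (k - 1)) * T (Suc i) k"
      using p_less[of k] k K(1)[of k] pos by (simp add: T_def)
    then have "0 < new k" using nonneg[OF k(2)] unfolding new_def by linarith
    then show ?thesis using P_new[of k] k by simp
  qed
  show ?thesis
    unfolding regular_def
  proof (intro conjI allI impI; (elim conjE)?)
    fix k assume "2 \<le> k" "k \<le> K"
    then show "P (Suc i) (k - 1) \<le> P (Suc i) k" using step by blast
  next
    fix k assume k: "k0 < k" "k \<le> K" "P (Suc i) (k - 1) \<le> t_high (Suc i)"
    then have "2 \<le> k" using k0(1) by simp
    then show "p k * (t_high (Suc i) - P (Suc i) k) \<le> p (k - 1) * (t_high (Suc i) - P (Suc i) (k - 1))"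
      using step[of k] k unfolding t_def by blast
  qed (use upper low high in blast)+
qed

lemma regular: "regular i"
  by (induction i) (auto intro: regular_0 regular_Suc)

section \<open>Linear comparison functions\<close>

lemma D_nonpos_persists:
  assumes "1 \<le> k" "k \<le> K" "D i k \<le> 0" "i \<le> j"
  shows "D j k \<le> 0"
  using assms(4,3)
proof (induction j rule: dec_induct)
  case (step j)
  then have D: "D j k \<le> 0" by simp
  have "(p k - p (k - 1)) * T (Suc j) k \<le> 0"
    using p_less[of k] T_nonpos[OF regular assms(1,2) D] K assms by (simp add: mult_nonneg_nonpos)
  moreover have "p (k - 1) * P j (k - 1) \<le> 0" "P j k = 0"
    using weighted_P_pred[OF regular assms(1,2), of j] D by auto
  ultimately show ?case
    using P_Suc[OF regular assms(1,2), of j] by (simp add: max_def split: if_splits)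
qed

lemma D_nonpos_pred:
  assumes "2 \<le> k" "k \<le> K" "D i k \<le> 0"
  shows "D i (k - 1) \<le> 0"
  using regularD(1)[OF regular assms(1,2), of i] assms(3) by (auto simp: max_def split: if_splits)

lemma y_eq: "y k = d k / mu1 S - 1"
  using params by (simp add: y_par_def d_def d_rate_def m_ratio_def field_simps)

lemma y_nonneg: "1 \<le> k \<Longrightarrow> 0 \<le> y k"
  using params by (simp add: y_par_def m_ratio_def)

lemma y_slope:
  assumes "1 \<le> k" "k \<le> N"
  shows "y k - y (k - 1) = (if k \<le> k0 then 1 else 1 - m_ratio S)"
proof -
  have "y k - y (k - 1) = (d k - d (k - 1)) / mu1 S"
    by (simp add: y_eq diff_divide_distrib)
  also have "d k - d (k - 1) = (if k \<le> k0 then mu1 S else mu1 S - mu2 S)"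
    using assms by (auto simp: d_low d_high of_nat_diff algebra_simps)
  finally show ?thesis using params by (simp add: m_ratio_def diff_divide_distrib)
qed

text \<open>
  Without the positive parts the left-hand side equals \<open>\<xi>\<close>. As \<open>s \<le> 1\<close>, the argument of the left column is
  at least \<open>\<xi>\<close>, so cutting it off when it is negative adds at most \<open>- p' * \<xi>\<close>. As \<open>s \<ge> 0\<close>, the left
  column is cut off whenever the right one is, and then only the negative resting term remains.
\<close>

lemma hinge_step:
  fixes p p' y s \<xi> :: real
  assumes "0 \<le> p'" "p' \<le> p" "p \<le> 1" "0 \<le> y" and s: "0 \<le> s" "s \<le> 1"
    and y: "(p - p') * y = 1 - p + p' * (1 - s)"
  shows "(p - p') * (\<xi> - y) + (1 - p) * max 0 (\<xi> + 1) + p' * max 0 (\<xi> + 1 - s) \<le> max 0 \<xi>"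
proof -
  have id: "(p - p') * (\<xi> - y) + (1 - p) * (\<xi> + 1) + p' * (\<xi> + 1 - s) = \<xi>"
    using y by (simp add: algebra_simps)
  show ?thesis
  proof (cases "0 \<le> \<xi> + 1")
    case ge: True
    have "p' * max 0 (\<xi> + 1 - s) \<le> p' * (\<xi> + 1 - s) + max 0 \<xi> - \<xi>"
    proof (cases "p' = 0 \<or> 0 \<le> \<xi> + 1 - s")
      case False
      then have "p' * (\<xi> - (\<xi> + 1 - s)) \<le> 0" "p' * (- \<xi>) \<le> 1 * (- \<xi>)"
        using assms by (auto intro!: mult_right_mono simp: mult_nonneg_nonpos)
      then show ?thesis using False by (simp add: algebra_simps)
    qed auto
    then show ?thesis using id ge by simp
  next
    case False
    then have *: "p' * max 0 (\<xi> + 1 - s) = 0" using s by auto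
    have "(p - p') * (\<xi> - y) \<le> 0"
      using False assms by (intro mult_nonneg_nonpos) auto
    then show ?thesis using False unfolding * by simp
  qed
qed

text \<open>
  The exact solutions \<open>a * (\<beta> + y k - i)\<close>, cut off at zero, are supersolutions. With \<open>m = N\<close> this bounds
  the threshold right of \<open>k0\<close>, as \<open>y k \<le> N - 1\<close> there; with \<open>m = k0\<close> it bounds the
  threshold left of \<open>k0\<close> by the estimate if \<open>h2 \<le> h0\<close>.
\<close>

lemma hinge_bound:
  assumes "0 \<le> a" "m \<le> K"
    and T: "\<And>i k. 1 \<le> k \<Longrightarrow> k \<le> m \<Longrightarrow> T i k \<le> a * (\<beta> - real i)"
    and D: "\<And>k. 1 \<le> k \<Longrightarrow> k \<le> m \<Longrightarrow> D 0 k \<le> a * max 0 (\<beta> + y k)"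
  shows "1 \<le> k \<Longrightarrow> k \<le> m \<Longrightarrow> P i k \<le> a * max 0 (\<beta> + y k - real i)"
proof (induction i arbitrary: k)
  case 0
  then show ?case using D[of k] \<open>0 \<le> a\<close> by simp
next
  case (Suc i)
  have kK: "k \<le> K" and kN: "k \<le> N" using Suc.prems assms K by auto
  define s where "s = y k - y (k - 1)"
  define \<xi> where "\<xi> = \<beta> + y k - real (Suc i)"
  have "0 \<le> s \<and> s \<le> 1"
  proof (cases "k \<le> k0")
    case False
    then have "mu2 S < mu1 S" using kK K(3) by simp
    then show ?thesis using False y_slope[of k] Suc.prems kN params by (simp add: s_def m_ratio_def)
  qed (use y_slope[of k] Suc.prems kN s_def in simp)
  then have s01: "0 \<le> s" "s \<le> 1" by auto
  have p: "0 \<le> p (k - 1)" "p (k - 1) \<le> p k" "p k \<le> 1"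
    using p_bounds p_less[of k] kN Suc.prems by auto
  have "p k * (1 + y k) = real k" "p (k - 1) * (1 + (y k - s)) = real k - 1"
    using p_y[OF kN] p_y[of "k - 1"] kN Suc.prems by (auto simp: s_def of_nat_diff)
  then have id: "(p k - p (k - 1)) * y k = 1 - p k + p (k - 1) * (1 - s)"
    by (simp add: algebra_simps)
  have "(p k - p (k - 1)) * T (Suc i) k \<le> (p k - p (k - 1)) * (a * (\<xi> - y k))"
    using T[OF Suc.prems, of "Suc i"] p by (intro mult_left_mono) (auto simp: \<xi>_def algebra_simps)
  moreover have "(1 - p k) * P i k \<le> (1 - p k) * (a * max 0 (\<xi> + 1))"
    using Suc.IH[OF Suc.prems] p by (intro mult_left_mono) (auto simp: \<xi>_def algebra_simps)
  moreover have "p (k - 1) * P i (k - 1) \<le> p (k - 1) * (a * max 0 (\<xi> + 1 - s))"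
  proof (cases "k = 1")
    case False
    then show ?thesis
      using Suc.IH[of "k - 1"] Suc.prems p
      by (intro mult_left_mono) (auto simp: \<xi>_def s_def algebra_simps)
  qed simp
  moreover have "(p k - p (k - 1)) * (a * (\<xi> - y k)) + (1 - p k) * (a * max 0 (\<xi> + 1))
      + p (k - 1) * (a * max 0 (\<xi> + 1 - s)) \<le> a * max 0 \<xi>"
    using mult_left_mono[OF hinge_step[OF p y_nonneg[OF Suc.prems(1)] s01 id, of \<xi>] \<open>0 \<le> a\<close>]
    by (simp add: algebra_simps)
  moreover have "0 \<le> a * max 0 \<xi>" using \<open>0 \<le> a\<close> by simp
  ultimately show ?case
    unfolding P_Suc[OF regular Suc.prems(1) kK] \<xi>_def by simp
qed

definition x :: real where "x = real c * m_ratio S"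
text \<open>
  The slope of the estimate, and its analogue with \<open>h2\<close> for \<open>h0\<close>: at time \<open>0\<close> the difference exceeds the
  estimate by \<open>(a2 - a) * y k\<close>, which explains the role of the sign of \<open>h2 - h0\<close>.
\<close>

definition a :: real where "a = h0 S / (real c * mu2 S)"
definition a2 :: real where "a2 = h2 S / (real c * mu2 S)"
abbreviation R :: "nat \<Rightarrow> real" where "R k \<equiv> R2_par S k"
abbreviation \<rho> :: real where "\<rho> \<equiv> r_base S"

lemma x_pos: "0 < x" and a_pos: "0 < a"
  using params by (auto simp: x_def a_def m_ratio_def)

lemma \<rho>: "\<rho> = x / (1 + x)" "0 < \<rho>" "\<rho> < 1"
  using x_pos by (auto simp: x_def r_base_def)

lemma coef_c'_eq: "coef_c' S = - a"
  by (simp add: coef_c'_def a_def)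

lemma a_R: "a * (R k - y k) = coef_b' S"
  using a_pos by (simp add: R2_par_def coef_c'_eq)

lemma t_low_eq: "t_low i = a * (R k - y k - real i)"
  using a_R[of k] by (simp add: t_low_def coef_c'_eq algebra_simps)

lemma D_0_eq: "1 \<le> k \<Longrightarrow> k \<le> k0 \<Longrightarrow> D 0 k = a * R k + (a2 - a) * y k"
  using D_0_low(2)[of k] a_R[of k] by (simp only: a2_def[symmetric]) (simp add: algebra_simps)

lemma y_low: "1 \<le> k \<Longrightarrow> k \<le> k0 \<Longrightarrow> y k = real k - 1 + x"
  using k0 by (simp add: y_par_def x_def min_absorb2)

lemma y_pred: "1 \<le> k \<Longrightarrow> k \<le> k0 \<Longrightarrow> y (k - 1) = y k - 1"
proof -
  assume k: "1 \<le> k" "k \<le> k0"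
  then have "k \<le> N" using k0(2) by simp
  from y_slope[OF k(1) this] k(2) show ?thesis by simp
qed

lemma R_pred: "1 \<le> k \<Longrightarrow> k \<le> k0 \<Longrightarrow> R (k - 1) = R k - 1"
  by (simp only: R2_par_def y_pred)

lemma y_pos: "1 \<le> k \<Longrightarrow> k \<le> k0 \<Longrightarrow> 0 < y k"
  using y_low[of k] x_pos by simp

lemma p_low:
  assumes "1 \<le> k" "k \<le> k0"
  shows "1 - p k = x / (y k + 1)" "p (k - 1) = (y k - x) / y k" "1 - p (k - 1) = x / y k"
proof -
  have "k \<le> N" using assms k0 by simp
  have y: "0 < y k" by (rule y_pos[OF assms])
  have "p k * (1 + y k) = real k" "p (k - 1) * y k = real k - 1"
    using p_y[of k] p_y[of "k - 1"] y_pred[OF assms] assms \<open>k \<le> N\<close> by (auto simp: of_nat_diff)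
  moreover have "real k - 1 = y k - x" using y_low[OF assms] by simp
  ultimately have *: "(1 - p k) * (y k + 1) = x" "p (k - 1) * y k = y k - x" "(1 - p (k - 1)) * y k = x"
    by (auto simp: algebra_simps)
  show "1 - p k = x / (y k + 1)" "p (k - 1) = (y k - x) / y k" "1 - p (k - 1) = x / y k"
    using y * by (auto simp: eq_divide_eq)
qed

text \<open>
  The affine part of the estimate \<open>H\<close>, also in the columns where \<open>H\<close> is set to \<open>-1\<close>.
\<close>

definition lin :: "nat \<Rightarrow> nat \<Rightarrow> real" where "lin i k = a * (R k - real i)"

text \<open>
  A supersolution of the homogeneous recursion that dominates \<open>y k\<close> at time \<open>0\<close>. The exponent is constant
  along the diagonals on which column \<open>k - 1\<close> feeds column \<open>k\<close>.
\<close>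

definition err :: "nat \<Rightarrow> nat \<Rightarrow> real" where "err i k = y k * \<rho> powi (int i + 1 - int k)"

lemma lin_Suc:
  assumes "1 \<le> k" "k \<le> k0"
  shows "lin (Suc i) k = (p k - p (k - 1)) * t_low (Suc i) + (1 - p k) * lin i k + p (k - 1) * lin i (k - 1)"
proof -
  have y: "0 < y k" by (rule y_pos[OF assms])
  have "(1 - p k) * (y k + 1) = x" using p_low(1)[OF assms] y by simp
  moreover have "p (k - 1) * y k = y k - x" using p_low(2)[OF assms] y by simp
  ultimately have "(p k - p (k - 1)) * y k = 1 - p k"
    by (simp add: algebra_simps)
  then have "a * ((p k - p (k - 1)) * y k) = a * (1 - p k)" by simp
  then show ?thesis
    unfolding lin_def t_low_eq[of _ k] R_pred[OF assms] by (simp add: algebra_simps)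
qed

text \<open>
  Write \<open>Y = y k\<close>. After division by \<open>\<rho>\<close> and the common power, the claim is
  \<open>(1 + x) * Y / (Y + 1) + (Y - x) * (Y - 1) / Y \<le> Y\<close>, and clearing denominators leaves \<open>x \<le> Y\<close>.
\<close>

lemma err_Suc:
  assumes "1 \<le> k" "k \<le> k0"
  shows "(1 - p k) * err i k + p (k - 1) * err i (k - 1) \<le> err (Suc i) k"
proof -
  define E where "E = \<rho> powi (int i + 1 - int k)"
  define Y where "Y = y k"
  have Y: "0 < Y" "x \<le> Y" using y_pos[OF assms] y_low[OF assms] assms by (auto simp: Y_def)
  have E: "0 < E" using \<rho>(2) by (simp add: E_def)
  have EE: "\<rho> powi (int i + 2 - int k) = \<rho> * E"
    using \<rho>(2) power_int_add_1'[of \<rho> "int i + 1 - int k"] by (simp add: E_def algebra_simps)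
  have "(1 + x) * Y / (Y + 1) + (Y - x) / Y * (Y - 1) \<le> Y"
  proof -
    have "(1 + x) * Y * Y + (Y - x) * (Y - 1) * (Y + 1) \<le> Y * (Y * (Y + 1))"
      using Y by (simp add: algebra_simps)
    then have "((1 + x) * Y * Y + (Y - x) * (Y - 1) * (Y + 1)) / (Y * (Y + 1)) \<le> Y"
      using Y by (simp add: pos_divide_le_eq)
    also have "((1 + x) * Y * Y + (Y - x) * (Y - 1) * (Y + 1)) / (Y * (Y + 1))
        = (1 + x) * Y / (Y + 1) + (Y - x) / Y * (Y - 1)"
      using Y by (simp add: add_divide_distrib)
    finally show ?thesis .
  qed
  then have "\<rho> * E * ((1 + x) * Y / (Y + 1) + (Y - x) / Y * (Y - 1)) \<le> \<rho> * E * Y"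
    using \<rho>(2) E by (intro mult_left_mono) auto
  moreover have "x / (Y + 1) * (Y * E) = \<rho> * E * ((1 + x) * Y / (Y + 1))"
    using x_pos Y by (simp add: \<rho>(1))
  moreover have "(Y - x) / Y * ((Y - 1) * (\<rho> * E)) = \<rho> * E * ((Y - x) / Y * (Y - 1))"
    by (simp only: ac_simps)
  ultimately have "x / (Y + 1) * (Y * E) + (Y - x) / Y * ((Y - 1) * (\<rho> * E)) \<le> Y * (\<rho> * E)"
    by (simp only: distrib_left mult.commute[of Y])
  moreover have "err i k = Y * E" by (simp only: err_def E_def Y_def)
  moreover have "err i (k - 1) = (Y - 1) * (\<rho> * E)"
  proof -
    have "int i + 1 - int (k - 1) = int i + 2 - int k" using assms by simp
    then show ?thesis by (simp only: err_def y_pred[OF assms] Y_def EE)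
  qed
  moreover have "err (Suc i) k = Y * (\<rho> * E)"
  proof -
    have "int (Suc i) + 1 - int k = int i + 2 - int k" by simp
    then show ?thesis by (simp only: err_def Y_def EE)
  qed
  ultimately show ?thesis
    by (simp only: p_low(1,2)[OF assms] Y_def)
qed

lemma err_0: "1 \<le> k \<Longrightarrow> k \<le> k0 \<Longrightarrow> y k \<le> err 0 k"
proof -
  assume k: "1 \<le> k" "k \<le> k0"
  have "\<rho> ^ (k - 1) \<le> 1" "0 < \<rho> ^ (k - 1)"
    using \<rho>(2,3) by (auto intro: power_le_one)
  then have "1 \<le> inverse (\<rho> ^ (k - 1))" by (intro one_le_inverse)
  also have "\<dots> = \<rho> powi (- int (k - 1))" by (simp only: power_int_minus power_int_of_nat)
  also have "- int (k - 1) = int 0 + 1 - int k" using k by simp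
  finally have "y k * 1 \<le> y k * \<rho> powi (int 0 + 1 - int k)"
    using y_pos[OF k] by (intro mult_left_mono) auto
  then show ?thesis by (simp only: err_def mult_1_right)
qed

lemma err_pos: "1 \<le> k \<Longrightarrow> k \<le> k0 \<Longrightarrow> 0 < err i k"
  using y_pos \<rho>(2) by (simp add: err_def)

section \<open>Comparison with the estimate\<close>

text \<open>
  A linear solution minus a supersolution of the homogeneous recursion is a subsolution, and cutting off
  at zero can only raise the solution. The choice \<open>g = 0\<close> serves \<open>h0 \<le> h2\<close>, the choice \<open>g = a - a2\<close> the
  opposite case.
\<close>

lemma P_lower:
  assumes g: "0 \<le> g" "a - a2 \<le> g"
  shows "1 \<le> k \<Longrightarrow> k \<le> k0 \<Longrightarrow> lin i k - g * err i k \<le> P i k"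
proof (induction i arbitrary: k)
  case 0
  have "g * y k \<le> g * err 0 k" using err_0[OF 0] g by (intro mult_left_mono) auto
  moreover have "(a - a2) * y k \<le> g * y k" using g y_pos[OF 0] by (intro mult_right_mono) auto
  ultimately have "lin 0 k - g * err 0 k \<le> D 0 k"
    using D_0_eq[OF 0] by (simp add: lin_def algebra_simps)
  then show ?case by simp
next
  case (Suc i)
  have kK: "k \<le> K" and kN: "k \<le> N" using Suc.prems k0 K by auto
  have "(1 - p k) * (lin i k - g * err i k) \<le> (1 - p k) * P i k"
    using Suc.IH[OF Suc.prems] p_bounds(2)[OF kN] by (intro mult_left_mono) auto
  moreover have "p (k - 1) * (lin i (k - 1) - g * err i (k - 1)) \<le> p (k - 1) * P i (k - 1)"
  proof (cases "k = 1")
    case False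
    then show ?thesis using Suc.IH[of "k - 1"] Suc.prems by (intro mult_left_mono p_bounds) auto
  qed simp
  moreover have "g * ((1 - p k) * err i k + p (k - 1) * err i (k - 1)) \<le> g * err (Suc i) k"
    using err_Suc[OF Suc.prems] g by (intro mult_left_mono) auto
  ultimately have "lin (Suc i) k - g * err (Suc i) k
      \<le> (p k - p (k - 1)) * t_low (Suc i) + (1 - p k) * P i k + p (k - 1) * P i (k - 1)"
    unfolding lin_Suc[OF Suc.prems] by (simp add: algebra_simps)
  then show ?case
    unfolding P_Suc[OF regular Suc.prems(1) kK] using Suc.prems(2) by (simp add: T_def le_max_iff_disj)
qed

text \<open>
  Up to time \<open>R k\<close> the linear solution is nonnegative in the columns \<open>k\<close> and, one step earlier, \<open>k - 1\<close>,
  so that the cut-off at zero does no harm.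
\<close>

lemma P_upper:
  assumes "a \<le> a2"
  shows "1 \<le> k \<Longrightarrow> k \<le> k0 \<Longrightarrow> real i \<le> R k \<Longrightarrow> P i k \<le> lin i k + (a2 - a) * err i k"
proof (induction i arbitrary: k)
  case 0
  have "(a2 - a) * y k \<le> (a2 - a) * err 0 k"
    using err_0[OF 0(1,2)] assms by (intro mult_left_mono) auto
  moreover have "0 \<le> (a2 - a) * y k" using assms y_pos[OF 0(1,2)] by simp
  moreover have "0 \<le> a * R k" using a_pos 0 by simp
  ultimately show ?case using D_0_eq[OF 0(1,2)] by (simp add: lin_def)
next
  case (Suc i)
  let ?g = "a2 - a"
  have k: "1 \<le> k" "k \<le> k0" by fact+
  have kK: "k \<le> K" and kN: "k \<le> N" using k k0 K by auto
  have "(1 - p k) * P i k \<le> (1 - p k) * (lin i k + ?g * err i k)"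
    using Suc.IH[OF k] Suc.prems(3) p_bounds(2)[OF kN] by (intro mult_left_mono) auto
  moreover have "p (k - 1) * P i (k - 1) \<le> p (k - 1) * (lin i (k - 1) + ?g * err i (k - 1))"
  proof (cases "k = 1")
    case False
    then show ?thesis
      using Suc.IH[of "k - 1"] Suc.prems R_pred[OF k] by (intro mult_left_mono p_bounds) auto
  qed simp
  moreover have "?g * ((1 - p k) * err i k + p (k - 1) * err i (k - 1)) \<le> ?g * err (Suc i) k"
    using err_Suc[OF k] assms by (intro mult_left_mono) auto
  ultimately have "(p k - p (k - 1)) * t_low (Suc i) + (1 - p k) * P i k + p (k - 1) * P i (k - 1)
      \<le> lin (Suc i) k + ?g * err (Suc i) k"
    unfolding lin_Suc[OF k] by (simp add: algebra_simps)
  moreover have "0 \<le> lin (Suc i) k" using a_pos Suc.prems(3) by (simp add: lin_def)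
  moreover have "0 \<le> ?g * err (Suc i) k" using assms err_pos[OF k] by (simp add: less_imp_le)
  ultimately show ?case
    unfolding P_Suc[OF regular k(1) kK] using k by (simp add: T_def)
qed

lemma a_le_a2_iff: "a \<le> a2 \<longleftrightarrow> h0 S \<le> h2 S" "a2 \<le> a \<longleftrightarrow> h2 S \<le> h0 S"
proof -
  have "0 < real c * mu2 S" using params by simp
  then show "a \<le> a2 \<longleftrightarrow> h0 S \<le> h2 S" "a2 \<le> a \<longleftrightarrow> h2 S \<le> h0 S"
    unfolding a_def a2_def by (simp_all only: divide_le_cancel) auto
qed

lemma nonpos_above_R:
  assumes "h2 S \<le> h0 S" "1 \<le> k" "k \<le> k0" "R k \<le> real i"
  shows "D i k \<le> 0"
proof -
  define \<beta> where "\<beta> = R 0 - y 0"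
  have R: "R k = \<beta> + y k" for k by (simp add: \<beta>_def R2_par_def)
  have "P i k \<le> a * max 0 (\<beta> + y k - real i)"
  proof (rule hinge_bound[where m = k0])
    show "T i k \<le> a * (\<beta> - real i)" if "1 \<le> k" "k \<le> k0" for i k
      using t_low_eq[of i k] that by (simp add: T_def R)
    show "D 0 k \<le> a * max 0 (\<beta> + y k)" if k: "1 \<le> k" "k \<le> k0" for k
    proof -
      have "(a2 - a) * y k \<le> 0"
        using assms(1) a_le_a2_iff y_pos[OF k] by (simp add: mult_nonpos_nonneg)
      moreover have "a * R k \<le> a * max 0 (R k)" using a_pos by simp
      ultimately show ?thesis using D_0_eq[OF k] by (simp add: R)
    qed
  qed (use a_pos K assms in auto)
  then show ?thesis using assms(4) by (simp add: R max_def split: if_splits)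
qed

lemma pos_below_R:
  assumes "h0 S \<le> h2 S" "1 \<le> k" "k \<le> k0" "real i < R k"
  shows "0 < D i k"
proof -
  have "0 < lin i k" using a_pos assms by (simp add: lin_def)
  then show ?thesis using P_lower[of 0 k i] assms a_le_a2_iff by (simp add: max_def split: if_splits)
qed

lemma pos_below_lin:
  assumes "h2 S \<le> h0 S" "1 \<le> k" "k \<le> k0" "(a - a2) * err i k < lin i k"
  shows "0 < D i k"
  using P_lower[of "a - a2" k i] assms a_le_a2_iff by (simp add: max_def split: if_splits)

text \<open>
  The condition gets weaker along the diagonal: power and right-hand side stay the same, while
  \<open>Y\<^sup>2 / (Y + 1)\<close> is increasing in \<open>Y\<close>.
\<close>

lemma cond_S_diagonal:
  assumes h: "h0 S < h2 S" and k: "2 \<le> k" "k \<le> k0"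
    and S: "(a2 - a) * (y k / (y k + 1) * (y k * \<rho> powi (int (Suc j) - int k))) \<le> a * (real (Suc j) - R k)"
  shows "(a2 - a) * (y (k - 1) / (y (k - 1) + 1) * (y (k - 1) * \<rho> powi (int j - int (k - 1))))
    \<le> a * (real j - R (k - 1))"
proof -
  define Y where "Y = y k"
  define Z where "Z = y (k - 1)"
  define E where "E = \<rho> powi (int (Suc j) - int k)"
  have E: "0 < E" using \<rho>(2) by (simp add: E_def)
  have YZ: "0 < Z" "Z \<le> Y" using y_pos[of "k - 1"] y_pred[of k] k by (auto simp: Y_def Z_def)
  have "Z / (Z + 1) \<le> Y / (Y + 1)" using YZ by (simp add: field_simps)
  then have "Z / (Z + 1) * (Z * E) \<le> Y / (Y + 1) * (Y * E)"
    using YZ E by (intro mult_mono) auto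
  then have "(a2 - a) * (Z / (Z + 1) * (Z * E)) \<le> (a2 - a) * (Y / (Y + 1) * (Y * E))"
    using h a_le_a2_iff by (intro mult_left_mono) auto
  also have "\<dots> \<le> a * (real (Suc j) - R k)" using S by (simp only: Y_def E_def)
  also have "\<dots> = a * (real j - R (k - 1))" using R_pred[of k] k by simp
  also have "E = \<rho> powi (int j - int (k - 1))"
  proof -
    have "int (Suc j) - int k = int j - int (k - 1)" using k by simp
    then show ?thesis by (simp only: E_def)
  qed
  finally show ?thesis by (simp only: Z_def)
qed

text \<open>
  The hypothesis is the condition (S) at an arbitrary time \<open>i\<close>, since \<open>r_k / (1 - q_k) = y k / (y k + 1)\<close>.
  By induction it makes the left neighbour nonpositive one step earlier, so that only column \<open>k\<close> itself
  feeds the step to time \<open>i\<close>. Inserting the upper bound there bounds the new value by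
  \<open>(1 - q_k) * a * (R k - i)\<close> plus an error, and the condition says that the error is absorbed.
\<close>

lemma nonpos_of_cond_S:
  assumes h: "h0 S < h2 S"
  shows "1 \<le> k \<Longrightarrow> k \<le> k0 \<Longrightarrow> i = 0 \<or> real i - 1 \<le> R k \<Longrightarrow>
    (a2 - a) * (y k / (y k + 1) * (y k * \<rho> powi (int i - int k))) \<le> a * (real i - R k) \<Longrightarrow> D i k \<le> 0"
proof (induction k arbitrary: i)
  case (Suc k')
  define k where "k = Suc k'"
  have k: "1 \<le> k" "k \<le> k0" "k - 1 = k'" using Suc.prems by (auto simp: k_def)
  have kK: "k \<le> K" and kN: "k \<le> N" using k k0 K by auto
  define g where "g = a2 - a"
  have g: "0 < g" using h a_le_a2_iff by (simp add: g_def not_le[symmetric])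
  define Y where "Y = y k"
  have Y: "0 < Y" "x \<le> Y" "Y = real k - 1 + x" using y_pos[OF k(1,2)] y_low[OF k(1,2)] k by (auto simp: Y_def)
  define E where "E = \<rho> powi (int i - int k)"
  have E: "0 < E" using \<rho>(2) by (simp add: E_def)
  have S: "g * (Y / (Y + 1) * (Y * E)) \<le> a * (real i - R k)"
    using Suc.prems(4) unfolding k_def[symmetric] g_def Y_def E_def .
  have "D i k \<le> 0"
  proof (cases i)
    case 0
    \<comment> \<open>At time \<open>0\<close> Bernoulli bounds the negative power of \<open>\<rho>\<close>, and the claim is read off the initial value.\<close>
    have "1 + real k * (1 / x) \<le> (1 + 1 / x) ^ k"
      using x_pos by (intro Bernoulli_inequality) (auto intro: order.trans[of _ 0])
    also have "1 + 1 / x = inverse \<rho>" using x_pos by (simp add: \<rho>(1) field_simps)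
    also have "inverse \<rho> ^ k = E" by (simp add: E_def 0 power_int_minus power_inverse)
    finally have "(Y + 1) / x \<le> E" using x_pos Y(3) by (simp add: field_simps)
    then have "Y / (Y + 1) * (Y * ((Y + 1) / x)) \<le> Y / (Y + 1) * (Y * E)"
      using Y by (intro mult_left_mono) auto
    moreover have "Y / (Y + 1) * (Y * ((Y + 1) / x)) = Y * (Y / x)"
      using Y by simp
    moreover have "Y * 1 \<le> Y * (Y / x)" using Y x_pos by (intro mult_left_mono) auto
    ultimately have "Y \<le> Y / (Y + 1) * (Y * E)" by linarith
    then have "g * Y \<le> g * (Y / (Y + 1) * (Y * E))" using g by (intro mult_left_mono) auto
    then show ?thesis
      using S D_0_eq[OF k(1,2)] 0 by (simp add: g_def Y_def)
  next
    case (Suc j)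
    have jR: "real j \<le> R k" using Suc.prems(3) Suc by (simp add: k_def)
    have pred: "p (k - 1) * P j (k - 1) = 0"
    proof (cases "k = 1")
      case False
      then have k': "1 \<le> k'" "k' \<le> k0" using k by auto
      have "(a2 - a) * (y k' / (y k' + 1) * (y k' * \<rho> powi (int j - int k'))) \<le> a * (real j - R k')"
        using cond_S_diagonal[OF h, of k j] S False k unfolding g_def Y_def E_def Suc by auto
      moreover have "real j - 1 \<le> R k'" using R_pred[OF k(1,2)] k(3) jR by simp
      ultimately have "D j k' \<le> 0"
        using Suc.IH[OF k', of j] by blast
      then show ?thesis using k(3) by simp
    qed simp
    have "P j k \<le> lin j k + g * err j k"
      using P_upper[OF _ k(1,2) jR] h a_le_a2_iff by (simp add: g_def)
    moreover have "err j k = Y * E"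
      by (simp add: err_def Y_def E_def Suc add.commute)
    ultimately have "(1 - p k) * P j k \<le> (1 - p k) * (lin j k + g * (Y * E))"
      using p_bounds(2)[OF kN] by (intro mult_left_mono) auto
    moreover have "(p k - p (k - 1)) * t_low (Suc j) + (1 - p k) * lin j k
        = (1 - p (k - 1)) * (a * (R k - real i))"
    proof -
      have "lin (Suc j) k = a * (R k - real i)" "lin j (k - 1) = a * (R k - real i)"
        using R_pred[OF k(1,2)] by (simp_all add: lin_def Suc)
      then show ?thesis using lin_Suc[OF k(1,2), of j] by (simp add: left_diff_distrib)
    qed
    moreover have "(1 - p (k - 1)) * (a * (R k - real i)) + (1 - p k) * (g * (Y * E)) \<le> 0"
    proof -
      have "(1 - p k) = (1 - p (k - 1)) * (Y / (Y + 1))"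
        using p_low(1,3)[OF k(1,2)] Y(1) by (simp add: Y_def)
      then have "(1 - p k) * (g * (Y * E)) = (1 - p (k - 1)) * (g * (Y / (Y + 1) * (Y * E)))"
        by simp
      moreover have "0 \<le> 1 - p (k - 1)" using p_bounds(2)[of "k - 1"] kN by simp
      moreover have "(1 - p (k - 1)) * (a * (R k - real i)) = - ((1 - p (k - 1)) * (a * (real i - R k)))"
        by (simp add: algebra_simps)
      ultimately show ?thesis
        using mult_left_mono[OF S, of "1 - p (k - 1)"] by linarith
    qed
    ultimately have "(p k - p (k - 1)) * t_low (Suc j) + (1 - p k) * P j k + p (k - 1) * P j (k - 1) \<le> 0"
      unfolding pred by (simp add: distrib_left)
    then show ?thesis
      using P_Suc[OF regular k(1) kK, of j] k(2) Suc by (simp add: T_def max_def split: if_splits)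
  qed
  then show ?case by (simp add: k_def)
qed simp

section \<open>The thresholds\<close>

lemma i_D_eq: "i_D S k = Inf (enat ` {i. D i k \<le> 0})"
  by (simp add: i_D_def D_def)

lemma i_D_eqI:
  assumes "1 \<le> k" "k \<le> K" "D n k \<le> 0" "n \<noteq> 0 \<Longrightarrow> 0 < D (n - 1) k"
  shows "i_D S k = enat n"
  unfolding i_D_eq
proof (rule Inf_enat_image_eq)
  show "i \<notin> {i. D i k \<le> 0}" if "i < n" for i
  proof
    assume "i \<in> {i. D i k \<le> 0}"
    then have "D (n - 1) k \<le> 0"
      using D_nonpos_persists[OF assms(1,2), of i "n - 1"] that by simp
    with assms(4) that show False by simp
  qed
qed (use assms(3) in simp)

lemma i_D_le: "D n k \<le> 0 \<Longrightarrow> i_D S k \<le> enat n"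
  unfolding i_D_eq by (rule Inf_enat_image_le) simp

lemma i_D_infinite: "(\<And>i. 0 < D i k) \<Longrightarrow> i_D S k = \<infinity>"
  unfolding i_D_eq by (simp add: not_le[symmetric] top_enat_def)

lemma i_D_0_iff: "i_D S k = 0 \<longleftrightarrow> D 0 k \<le> 0"
proof
  assume "i_D S k = 0"
  then show "D 0 k \<le> 0"
    using Inf_enat_image_attained[of "{i. D i k \<le> 0}" 0] by (simp add: i_D_eq zero_enat_def)
next
  assume "D 0 k \<le> 0"
  then show "i_D S k = 0" using i_D_le[of 0 k] by (simp add: zero_enat_def[symmetric])
qed

lemma i_D_mono:
  assumes "2 \<le> k" "k \<le> N"
  shows "i_D S (k - 1) \<le> i_D S k"
proof (cases "k \<le> K")
  case True
  then have "{i. D i k \<le> 0} \<subseteq> {i. D i (k - 1) \<le> 0}"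
    using D_nonpos_pred assms by auto
  then show ?thesis unfolding i_D_eq by (intro Inf_superset_mono image_mono)
next
  case False
  then have "i_D S k = \<infinity>"
    using assms by (intro i_D_infinite D_pos_high) (auto simp: K_def split: if_splits)
  then show ?thesis by simp
qed

lemma H_high: "k0 < k \<Longrightarrow> k \<le> N \<Longrightarrow> H_fun S i k (N - k) = t_high i"
  using k0(4)[of k] by (simp add: H_fun_def t_high_def add.commute)

lemma i_H_le_i_D_high:
  assumes "mu2 S < mu1 S" "k0 < k" "k \<le> N"
  shows "i_H S k \<le> i_D S k"
proof -
  have "t_high i \<le> 0" if "D i k \<le> 0" for i
    using regularD(4)[OF regular assms(2), of i] assms that by (auto simp: K_def not_less[symmetric])
  then have "{i. D i k \<le> 0} \<subseteq> {i. H_fun S i k (N - k) \<le> 0}"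
    using H_high assms by auto
  then show ?thesis unfolding i_D_eq i_H_def by (intro Inf_superset_mono image_mono)
qed

text \<open>
  The resting level right of \<open>k0\<close> is nonpositive from the estimated threshold on and dominates the one
  left of \<open>k0\<close>. The difference lags behind it by at most \<open>y k \<le> N - 1\<close> time units.
\<close>

lemma i_D_le_i_H_high:
  assumes mu: "mu2 S < mu1 S" and k: "k0 < k" "k \<le> N"
  shows "i_D S k \<le> i_H S k + enat (N - 1)"
proof (cases "i_H S k")
  case (enat n)
  then have n: "t_high n \<le> 0"
    using Inf_enat_image_attained[of "{i. H_fun S i k (N - k) \<le> 0}" n] H_high[OF k]
    by (simp add: i_H_def)
  define \<beta> where "\<beta> = coef_b S / - coef_c S"
  have c: "0 < - coef_c S" using coef_c_neg[OF mu] by simp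
  have t_high: "t_high i = - coef_c S * (\<beta> - real i)" for i
    using c by (simp add: \<beta>_def t_high_def algebra_simps)
  have "0 < \<beta>" unfolding \<beta>_def using c coef_b_pos by (rule divide_pos_pos[rotated])
  moreover have "\<beta> \<le> real n"
    using n c unfolding t_high mult_le_0_iff by linarith
  ultimately have \<beta>: "0 < \<beta>" "\<beta> \<le> real n" .
  have K: "K = N" using mu by (simp add: K_def)
  have "P (n + (N - 1)) k \<le> - coef_c S * max 0 (\<beta> + y k - real (n + (N - 1)))"
  proof (rule hinge_bound[where m = N])
    show "T i k \<le> - coef_c S * (\<beta> - real i)" for i k
      using t_low_le_t_high[of i] by (simp add: T_def t_high)
    show "D 0 k \<le> - coef_c S * max 0 (\<beta> + y k)" if k: "1 \<le> k" "k \<le> N" for k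
    proof -
      have "D 0 k \<le> coef_b S" by (rule D_0_le_b[OF k])
      also have "\<dots> = - coef_c S * \<beta>" using c by (simp add: \<beta>_def)
      also have "\<dots> \<le> - coef_c S * max 0 (\<beta> + y k)"
        using c y_nonneg[OF k(1)] \<beta> by (intro mult_left_mono) auto
      finally show ?thesis .
    qed
  qed (use c K k in auto)
  moreover have "y k \<le> real N - 1"
  proof -
    have "d k \<le> real k * mu1 S + (real N - real k) * mu1 S"
      using d_high[of k] k mu params by (simp add: mult_left_mono)
    then have "d k / mu1 S \<le> real N"
      using params by (simp add: pos_divide_le_eq algebra_simps)
    then show ?thesis by (simp add: y_eq)
  qed
  moreover have "real (n + (N - 1)) = real n + (real N - 1)" using params by (simp add: of_nat_diff)
  ultimately have "P (n + (N - 1)) k \<le> - coef_c S * max 0 (\<beta> + y k - (real n + (real N - 1)))"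
    and "\<beta> + y k - (real n + (real N - 1)) \<le> 0"
    using \<beta> by auto
  then have "D (n + (N - 1)) k \<le> 0" by (simp add: max_absorb1)
  from i_D_le[OF this] show ?thesis by (simp add: enat)
qed simp

lemma thresholds_infinite:
  assumes "mu1 S \<le> mu2 S" "k0 < k" "k \<le> N"
  shows "i_D S k = \<infinity>" "i_H S k = \<infinity>"
proof -
  show "i_D S k = \<infinity>" using D_pos_high assms by (intro i_D_infinite)
  have "0 < t_high i" for i
    using coef_b_pos coef_c_nonneg[OF assms(1)] by (simp add: t_high_def add_pos_nonneg)
  then have "{i. H_fun S i k (N - k) \<le> 0} = {}"
    using H_high[OF assms(2,3)] by (simp add: not_le)
  then show "i_H S k = \<infinity>" by (simp add: i_H_def top_enat_def)
qed

lemma H_low: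
  assumes "1 \<le> k" "k \<le> k0" "0 < D 0 k"
  shows "H_fun S i k (N - k) \<le> 0 \<longleftrightarrow> R k \<le> real i"
proof -
  have "c \<le> N - k" using assms k0 by auto
  moreover have "\<not> h1 S / mu1 S \<le> (real (N - k) + 1) / real c * (h2 S / mu2 S)"
    using D_0_low(1)[OF assms(1,2)] assms(3) by simp
  ultimately have "H_fun S i k (N - k) = a * (R k - real i)"
    using a_R[of k] by (simp add: H_fun_def coef_c'_eq algebra_simps)
  then show ?thesis using a_pos by (simp add: mult_le_0_iff)
qed

lemma i_H_low:
  assumes "1 \<le> k" "k \<le> k0" "0 < D 0 k"
  obtains n where "i_H S k = enat n" "R k \<le> real n" "n = 0 \<or> real (n - 1) < R k"
proof -
  have "i_H S k = enat (nat \<lceil>R k\<rceil>)"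
    unfolding i_H_def
  proof (rule Inf_enat_image_eq)
    show "nat \<lceil>R k\<rceil> \<in> {i. H_fun S i k (N - k) \<le> 0}"
      using H_low[OF assms] by (simp add: real_nat_ceiling_ge)
    show "i \<notin> {i. H_fun S i k (N - k) \<le> 0}" if "i < nat \<lceil>R k\<rceil>" for i
      using H_low[OF assms, of i] that by (simp add: not_le) linarith
  qed
  moreover have "nat \<lceil>R k\<rceil> = 0 \<or> real (nat \<lceil>R k\<rceil> - 1) < R k"
    by linarith
  ultimately show thesis using that[OF _ real_nat_ceiling_ge] by blast
qed

text \<open>
  Both claims follow from the signs of four differences, at times \<open>n\<close> and \<open>n - 1\<close> in column \<open>k\<close> and at
  times \<open>n - 1\<close> and \<open>n - 2\<close> in column \<open>k - 1\<close>, where \<open>n\<close> is the estimated threshold of column \<open>k\<close>. As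
  \<open>R (k - 1) = R k - 1\<close>, each argument for column \<open>k\<close> applies to column \<open>k - 1\<close> one step earlier,
  whether or not the difference in that column starts out positive.
\<close>

lemma exact_thresholds:
  assumes k: "1 \<le> k" "k \<le> k0" "0 < D 0 k"
    and cond: "h0 S = h2 S \<or> h0 S > h2 S \<and> cond_Q S k \<or> h0 S < h2 S \<and> cond_S S k"
  shows "i_D S k = i_H S k" and "2 \<le> k \<Longrightarrow> i_D S k = i_D S (k - 1) + 1"
proof -
  obtain n where n: "i_H S k = enat n" "R k \<le> real n" "n = 0 \<or> real (n - 1) < R k"
    by (rule i_H_low[OF k])
  have kK: "k \<le> K" using k K by simp
  have pred: "R (k - 1) = R k - 1" "y (k - 1) = y k - 1" using R_pred y_pred k by auto
  have upper: "D n k \<le> 0 \<and> (2 \<le> k \<longrightarrow> 1 \<le> n \<longrightarrow> D (n - 1) (k - 1) \<le> 0)"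
  proof (cases "h2 S \<le> h0 S")
    case True
    then show ?thesis
      using nonpos_above_R[of k n] nonpos_above_R[of "k - 1" "n - 1"] k n pred by (auto simp: of_nat_diff)
  next
    case False
    then have h: "h0 S < h2 S" and "cond_S S k" using cond by auto
    have g: "0 < a2 - a" using h a_le_a2_iff by (simp add: not_le[symmetric])
    have ratio: "h0 S / (h2 S - h0 S) = a / (a2 - a)"
      using params h by (simp add: a_def a2_def diff_divide_distrib[symmetric])
    have rq: "r_par S k / (1 - q_par S k) = y k / (y k + 1)"
    proof -
      have "r_par S k = 1 - p k"
        using k k0 params by (simp add: one_minus_p r_par_def d_def d_rate_def m_ratio_def field_simps)
      moreover have "q_par S k = p (k - 1)"
        using k k0 params
        by (simp add: p_def q_par_def d_def d_rate_def m_ratio_def of_nat_diff Suc_diff_le field_simps)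
      ultimately show ?thesis
        using p_low(1,3)[OF k(1,2)] y_pos[OF k(1,2)] x_pos by simp
    qed
    have S: "(a2 - a) * (y k / (y k + 1) * (y k * \<rho> powi (int n - int k))) \<le> a * (real n - R k)"
      using \<open>cond_S S k\<close> g unfolding cond_S_def n(1) ratio rq the_enat.simps
      by (simp add: pos_le_divide_eq mult.commute mult.assoc)
    have "D n k \<le> 0"
      by (rule nonpos_of_cond_S[OF h k(1,2) _ S]) (use n(3) in \<open>cases n; auto\<close>)
    moreover have "D (n - 1) (k - 1) \<le> 0" if kn: "2 \<le> k" "1 \<le> n"
    proof (rule nonpos_of_cond_S[OF h])
      have "Suc (n - 1) = n" using kn by simp
      then show "(a2 - a) * (y (k - 1) / (y (k - 1) + 1) * (y (k - 1) * \<rho> powi (int (n - 1) - int (k - 1))))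
          \<le> a * (real (n - 1) - R (k - 1))"
        using cond_S_diagonal[OF h kn(1) k(2), of "n - 1"] S by metis
      show "n - 1 = 0 \<or> real (n - 1) - 1 \<le> R (k - 1)" using n(3) kn pred by auto
    qed (use kn k in auto)
    ultimately show ?thesis by blast
  qed
  have lower: "(1 \<le> n \<longrightarrow> 0 < D (n - 1) k) \<and> (2 \<le> k \<longrightarrow> 2 \<le> n \<longrightarrow> 0 < D (n - 2) (k - 1))"
  proof (cases "h0 S \<le> h2 S")
    case True
    then show ?thesis
      using pos_below_R[of k "n - 1"] pos_below_R[of "k - 1" "n - 2"] k n pred by (auto simp: of_nat_diff)
  next
    case False
    then have h: "h2 S < h0 S" and "cond_Q S k" using cond by auto
    have g: "0 < a - a2" using h a_le_a2_iff by (simp add: not_le[symmetric])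
    have ratio: "h0 S / (h0 S - h2 S) = a / (a - a2)"
      using params h by (simp add: a_def a2_def diff_divide_distrib[symmetric])
    have Q: "(a - a2) * (y k * \<rho> powi (int n - int k)) < a * (R k - (real n - 1))"
      using \<open>cond_Q S k\<close> g unfolding cond_Q_def n(1) ratio the_enat.simps
      by (simp add: pos_less_divide_eq mult.commute mult.assoc)
    have "0 < D (n - 1) k" if "1 \<le> n"
      using Q that h k by (intro pos_below_lin) (auto simp: err_def lin_def of_nat_diff)
    moreover have "0 < D (n - 2) (k - 1)" if kn: "2 \<le> k" "2 \<le> n"
    proof (rule pos_below_lin)
      have "(a - a2) * err (n - 2) (k - 1) = (a - a2) * ((y k - 1) * \<rho> powi (int n - int k))"
        using kn pred by (simp add: err_def of_nat_diff)
      also have "\<dots> \<le> (a - a2) * (y k * \<rho> powi (int n - int k))"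
        using g \<rho>(2) by (intro mult_left_mono mult_right_mono) auto
      also note Q
      also have "a * (R k - (real n - 1)) = lin (n - 2) (k - 1)"
        using kn pred by (simp add: lin_def of_nat_diff)
      finally show "(a - a2) * err (n - 2) (k - 1) < lin (n - 2) (k - 1)" .
    qed (use kn h k in auto)
    ultimately show ?thesis by blast
  qed
  have n0: "1 \<le> n" using upper k(3) by (cases n) auto
  have iD: "i_D S k = enat n" using upper lower k kK by (intro i_D_eqI) auto
  then show "i_D S k = i_H S k" using n by simp
  assume "2 \<le> k"
  then have "i_D S (k - 1) = enat (n - 1)"
    using upper lower n0 kK by (intro i_D_eqI) (auto simp: numeral_2_eq_2)
  then show "i_D S k = i_D S (k - 1) + 1" using iD n0 by (simp add: one_enat_def)
qed

lemma i_H_ge_i_D: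
  assumes "1 \<le> k" "k \<le> k0" "0 < D 0 k" "h2 S \<le> h0 S"
  shows "i_D S k \<le> i_H S k"
proof -
  obtain n where "i_H S k = enat n" "R k \<le> real n" by (rule i_H_low[OF assms(1-3)])
  then show ?thesis using i_D_le[OF nonpos_above_R[of k n]] assms by simp
qed

lemma i_H_le_i_D:
  assumes "1 \<le> k" "k \<le> k0" "0 < D 0 k" "h0 S \<le> h2 S"
  shows "i_H S k \<le> i_D S k"
proof -
  have "R k \<le> real i" if "D i k \<le> 0" for i
    using pos_below_R[of k i] assms that by (auto simp: not_less[symmetric])
  then have "{i. D i k \<le> 0} \<subseteq> {i. H_fun S i k (N - k) \<le> 0}"
    using H_low[OF assms(1-3)] by auto
  then show ?thesis unfolding i_D_eq i_H_def by (intro Inf_superset_mono image_mono)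
qed

end

theorem theorem4p1:
  fixes S :: clearing_system
  assumes "valid_system S"
    and "h1 S / mu1 S > h2 S / mu2 S"
  shows
    "(\<forall>k\<in>{2..C1 S}. i_D S (k - 1) \<le> i_D S k)
     \<and> (\<forall>k\<in>{1..C1 S}. C1 S - k < C2 S \<longrightarrow>
          (mu1 S > mu2 S \<longrightarrow>
             i_H S k \<le> i_D S k \<and> i_D S k \<le> i_H S k + enat (C1 S - 1)) \<and>
          (mu1 S \<le> mu2 S \<longrightarrow> i_D S k = \<infinity> \<and> i_H S k = \<infinity>))
     \<and> (\<forall>k\<in>{1..C1 S}. \<forall>l. l = C1 S - k \<longrightarrow> l \<ge> C2 S \<longrightarrow>
          (h1 S / mu1 S \<le> (real l + 1) / real (C2 S) * (h2 S / mu2 S) \<longleftrightarrow> i_D S k = 0) \<and>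
          (h1 S / mu1 S \<le> (real l + 1) / real (C2 S) * (h2 S / mu2 S) \<or> i_D S k = 0
             \<longrightarrow> i_H S k = 0) \<and>
          (h1 S / mu1 S > (real l + 1) / real (C2 S) * (h2 S / mu2 S) \<longrightarrow>
             i_D S k \<ge> 1 \<and>
             (h0 S \<ge> h2 S \<longrightarrow> i_H S k \<ge> i_D S k) \<and>
             (h0 S \<le> h2 S \<longrightarrow> i_H S k \<le> i_D S k) \<and>
             (h0 S = h2 S \<longrightarrow> i_H S k = i_D S k) \<and>
             (h0 S > h2 S \<and> cond_Q S k \<longrightarrow> i_H S k = i_D S k) \<and>
             (h0 S < h2 S \<and> cond_S S k \<longrightarrow> i_H S k = i_D S k) \<and>
             (k \<ge> 2 \<and>
                (h0 S = h2 S \<or> h0 S > h2 S \<and> cond_Q S k \<or> h0 S < h2 S \<and> cond_S S k)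
                \<longrightarrow> i_D S k = i_D S (k - 1) + 1)))"
proof -
  interpret clearing S by (unfold_locales) (use assms in auto)
  have high: "k0 < k" if "k \<in> {1..C1 S}" "C1 S - k < C2 S" for k
    using k0(4)[of k] that by auto
  have low: "k \<le> k0" if "k \<in> {1..C1 S}" "C2 S \<le> C1 S - k" for k
    using k0(4)[of k] that by auto
  have test: "h1 S / mu1 S \<le> (real (C1 S - k) + 1) / real (C2 S) * (h2 S / mu2 S) \<longleftrightarrow> D 0 k \<le> 0"
    if "k \<in> {1..C1 S}" "C2 S \<le> C1 S - k" for k
    using D_0_low(1)[of k] low[OF that] that by simp
  have i_H_0: "i_H S k = 0" if "k \<in> {1..C1 S}" "C2 S \<le> C1 S - k" "D 0 k \<le> 0" for k
  proof -
    have "i_H S k \<le> enat 0"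
      unfolding i_H_def using that test[of k] by (intro Inf_enat_image_le) (simp add: H_fun_def)
    then show ?thesis by (simp add: zero_enat_def[symmetric])
  qed
  show ?thesis
  proof (intro conjI ballI allI impI)
    show "i_D S (k - 1) \<le> i_D S k" if "k \<in> {2..C1 S}" for k
      using i_D_mono that by simp
  next
    fix k assume k: "k \<in> {1..C1 S}" "C1 S - k < C2 S"
    have kN: "k \<le> C1 S" using k by simp
    show "i_H S k \<le> i_D S k" "i_D S k \<le> i_H S k + enat (C1 S - 1)" if "mu2 S < mu1 S"
      using i_H_le_i_D_high[OF that high[OF k] kN] i_D_le_i_H_high[OF that high[OF k] kN] by auto
    show "i_D S k = \<infinity>" "i_H S k = \<infinity>" if "mu1 S \<le> mu2 S"
      using thresholds_infinite[OF that high[OF k] kN] by auto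
  next
    fix k l assume k: "k \<in> {1..C1 S}" and l: "l = C1 S - k" "C2 S \<le> l"
    have kl: "C2 S \<le> C1 S - k" using l by simp
    have k1: "1 \<le> k" "k \<le> k0" using low[OF k kl] k by auto
    show "h1 S / mu1 S \<le> (real l + 1) / real (C2 S) * (h2 S / mu2 S) \<longleftrightarrow> i_D S k = 0"
      using test[OF k kl] l i_D_0_iff by simp
    show "i_H S k = 0"
      if "h1 S / mu1 S \<le> (real l + 1) / real (C2 S) * (h2 S / mu2 S) \<or> i_D S k = 0"
      using i_H_0[OF k kl] test[OF k kl] l i_D_0_iff that by auto
    assume "(real l + 1) / real (C2 S) * (h2 S / mu2 S) < h1 S / mu1 S"
    then have D0: "0 < D 0 k" using test[OF k kl] l by auto
    show "1 \<le> i_D S k" using D0 i_D_0_iff[of k] by (simp add: one_eSuc ileI1 zero_less_iff_neq_zero)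
    show "i_D S k \<le> i_H S k" if "h2 S \<le> h0 S"
      by (rule i_H_ge_i_D[OF k1 D0 that])
    show "i_H S k \<le> i_D S k" if "h0 S \<le> h2 S"
      by (rule i_H_le_i_D[OF k1 D0 that])
    show "i_H S k = i_D S k" if "h0 S = h2 S"
      using exact_thresholds(1)[OF k1 D0] that by auto
    show "i_H S k = i_D S k" if "h2 S < h0 S \<and> cond_Q S k"
      using exact_thresholds(1)[OF k1 D0] that by auto
    show "i_H S k = i_D S k" if "h0 S < h2 S \<and> cond_S S k"
      using exact_thresholds(1)[OF k1 D0] that by auto
    show "i_D S k = i_D S (k - 1) + 1"
      if "2 \<le> k \<and> (h0 S = h2 S \<or> h2 S < h0 S \<and> cond_Q S k \<or> h0 S < h2 S \<and> cond_S S k)"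
      using exact_thresholds(2)[OF k1 D0] that by blast
  qed
qed

end
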